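(* In the RESTART model with task time density $f$, failure time distribution $G$ with density $g$, and total time $X$, let $\beta>0$ and assume $$f(t)=g(t)\,\overline G(t)^{\beta-1}\,L_0\bigl(\overline G(t)\bigr),$$ where $L_0(s)$ is slowly varying at $s=0$. Then $$\overline H(x)\ \sim\ \frac{\Gamma(\beta)}{\mu^\beta}\,\frac{L_0(1/x)}{x^\beta},\qquad x\to\infty .$$
   Context: RESTART model: $T$ is a nonnegative random variable (task time) with distribution $F$ having density $f$ on $[0,\infty)$. $U, U_1,U_2,\ldots$ are nonnegative i.i.d. random variables (failure times) with distribution $G$ having density $g$, independent of $T$. $N=\inf\{n\ge 0:\,U_{n+1}>T\}$, $S=\sum_{i=1}^N U_i$, and the total time is $X=T+S$ (with $X=\infty$ if $N=\infty$). Write $\overline G(t)=\mathbb P(U>t)$, $\overline H(x)=\mathbb P(X>x)$, $\mu=1/\mathbb E U$. Standing assumptions: $\mu>0$ (i.e. $\mathbb E U<\infty$) and the support of $F$ is unbounded. Slowly varying functions are assumed to be bounded on compact subsets of $(0,\infty)$; $L_0$ slowly varying at $0$ means $L_0(cs)/L_0(s)\to1$ as $s\downarrow0$ for every $c>0$. $a(x)\sim b(x)$ means $a(x)/b(x)\to1$. *)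

theory Defs
  imports "HOL-Probability.Probability" "HOL-Library.Landau_Symbols"
begin

definition tail_prob :: "'a measure \<Rightarrow> ('a \<Rightarrow> 'b::linorder) \<Rightarrow> 'b \<Rightarrow> real" where
  "tail_prob M Y y = measure M {\<omega> \<in> space M. Y \<omega> > y}"

definition has_density_nonneg :: "'a measure \<Rightarrow> ('a \<Rightarrow> real) \<Rightarrow> (real \<Rightarrow> real) \<Rightarrow> bool" where
  "has_density_nonneg M Y h \<longleftrightarrow>
     (\<forall>t\<ge>0. h t \<ge> 0) \<and>
     distributed M lborel Y (\<lambda>t. ennreal (indicator {0..} t * h t))"

definition measure_support :: "'b::topological_space measure \<Rightarrow> 'b set" where
  "measure_support D = {x. \<forall>V. open V \<longrightarrow> x \<in> V \<longrightarrow> emeasure D V > 0}"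

(* The infimum is taken in enat, where Inf {} = \<infinity>. *)
definition restart_N :: "('a \<Rightarrow> real) \<Rightarrow> (nat \<Rightarrow> 'a \<Rightarrow> real) \<Rightarrow> 'a \<Rightarrow> enat" where
  "restart_N T U \<omega> = Inf {enat n | n. U (n + 1) \<omega> > T \<omega>}"

definition restart_X :: "('a \<Rightarrow> real) \<Rightarrow> (nat \<Rightarrow> 'a \<Rightarrow> real) \<Rightarrow> 'a \<Rightarrow> ereal" where
  "restart_X T U \<omega> =
     (case restart_N T U \<omega> of
        enat n \<Rightarrow> ereal (T \<omega> + (\<Sum>i=1..n. U i \<omega>))
      | \<infinity> \<Rightarrow> \<infinity>)"

(* The failure times are U 1, U 2, ...; the value U 0 is never used, and U 1 serves as the
   generic failure time. The U i are identically distributed because they share the density g.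
   Mutual independence of T, U 1, U 2, ... says both that the U i are independent and that the
   whole sequence is independent of T.
   A finite mean (integrable) is the condition \<mu> > 0; it has to be said via integrability because
   the expectation of a non-integrable variable is 0 in HOL. *)
locale restart_model = prob_space M for M :: "'a measure" +
  fixes T :: "'a \<Rightarrow> real" and U :: "nat \<Rightarrow> 'a \<Rightarrow> real" and f g :: "real \<Rightarrow> real"
  assumes T_nonneg: "AE \<omega> in M. T \<omega> \<ge> 0"
    and U_nonneg: "\<And>i. i \<ge> 1 \<Longrightarrow> AE \<omega> in M. U i \<omega> \<ge> 0"
    and T_density: "has_density_nonneg M T f"
    and U_density: "\<And>i. i \<ge> 1 \<Longrightarrow> has_density_nonneg M (U i) g"
    and T_U_indep: "indep_vars (\<lambda>_. borel) (\<lambda>n::nat. if n = 0 then T else U n) UNIV"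
    and U_integrable: "integrable M (U 1)"
    and T_support_unbounded: "\<not> bounded (measure_support (distr M borel T))"

(* With x / 0 = 0 the case c = 1 of the limit already forces L s \<noteq> 0 for all small s > 0. *)
definition slowly_varying_at_0 :: "(real \<Rightarrow> real) \<Rightarrow> bool" where
  "slowly_varying_at_0 L \<longleftrightarrow>
     (\<forall>K. compact K \<longrightarrow> K \<subseteq> {0<..} \<longrightarrow> bounded (L ` K)) \<and>
     (\<forall>c>0. ((\<lambda>s. L (c * s) / L s) \<longlongrightarrow> 1) (at_right 0))"

end

theory Submission
  imports Defs
begin

text \<open>
  Given \<open>T = t\<close>, the run ends with the first failure time above \<open>t\<close>. Each failure time exceeds \<open>t\<close>
  with probability \<open>p = G_tail t\<close>, so about a geometric number of restarts with success probability \<open>p\<close>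
  is needed. Each of them costs \<open>mean\<close> on average, and for rare successes the law of large numbers makes
  the conditional tail \<open>restart_tail x t = P(X > x | T = t)\<close> close to \<open>exp (- x p / mean)\<close>. The relation
  between \<open>f\<close> and \<open>g\<close> is chosen such that the law of \<open>T\<close>, read in the variable \<open>s = G_tail t\<close> (which is
  uniform on \<open>(0, 1)\<close> under the law of \<open>U 1\<close>), has density \<open>s powr (\<beta> - 1) * L0 s\<close>. Hence the tail of
  \<open>X\<close> is close to the Laplace transform of this density at \<open>x / mean\<close>, and an Abelian theorem gives its
  decay.

  Two facts make this precise. The pointwise limit along \<open>x p \<rightarrow> y\<close> is \<open>restart_tail_limit\<close>, and
  \<open>restart_tail_exp_bound\<close> bounds the conditional tail by a multiple of \<open>exp (- c x p)\<close> for
  all \<open>x \<ge> 0\<close> and \<open>t \<ge> 0\<close> at once. Both come from the same two inequalities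
  \<open>restart_tail_upper\<close> and \<open>restart_tail_lower\<close>: within the first \<open>n\<close> failure times, either all stay
  below \<open>t\<close>, an event of probability \<open>(1 - p)^n\<close>, or the run is already over; whether their sum reaches
  \<open>x\<close> is controlled by Chernoff bounds. For the upper bound the failure times may be truncated at \<open>t\<close>,
  so no exponential moment of \<open>U 1\<close> is required.

  The Abelian theorem \<open>abelian_slowly_varying\<close> is stated for kernels that converge after rescaling and
  obey such an exponential bound. It is dominated convergence after the substitution \<open>y = x s\<close>, the
  dominating function being supplied by the Potter bounds \<open>slowly_varying_potter\<close>. These rest on the
  uniform convergence theorem \<open>slowly_varying_uniform\<close>, which needs a measurable function. Measurability
  of \<open>L0\<close> follows from the relation between the two densities: composed with the
  quantile function of the failure time, it exhibits \<open>L0\<close> on \<open>(0, 1)\<close> as almost everywhere equal to a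
  Borel function, hence Lebesgue measurable. For this reason all integrals against \<open>L0\<close> are taken with
  respect to \<open>lebesgue\<close> instead of \<open>lborel\<close>.
\<close>

section \<open>Uniform convergence for measurable slowly varying functions\<close>

lemma borel_measurable_lebesgue_cong_AE:
  fixes h h' :: "real \<Rightarrow> real"
  assumes h': "h' \<in> borel_measurable borel" and eq: "AE x in lborel. h x = h' x"
  shows "h \<in> borel_measurable lebesgue"
proof (rule measurableI)
  fix A :: "real set" assume A: "A \<in> sets borel"
  have h'_leb: "h' \<in> borel_measurable lebesgue"
    using h' by (simp add: measurable_completion)
  have ne: "{x. h x \<in> A \<and> h x \<noteq> h' x} \<in> sets lebesgue" "{x. h x \<noteq> h' x} \<in> sets lebesgue"
    using sets_completion_AE[where M = lborel and P = "\<lambda>x. h x \<in> A \<and> h x \<noteq> h' x"]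
      sets_completion_AE[where M = lborel and P = "\<lambda>x. h x \<noteq> h' x"] eq
    by (auto simp: pred_def eventually_mono[OF eq])
  have "h -` A \<inter> space lebesgue
      = (h' -` A \<inter> space lebesgue - {x. h x \<noteq> h' x}) \<union> {x. h x \<in> A \<and> h x \<noteq> h' x}"
    by auto
  also have "\<dots> \<in> sets lebesgue"
    using ne measurable_sets[OF h'_leb A] by blast
  finally show "h -` A \<inter> space lebesgue \<in> sets lebesgue" .
qed simp

lemma measurable_lebesgue_mult:
  fixes h :: "real \<Rightarrow> real"
  assumes "h \<in> borel_measurable lebesgue"
  shows "(\<lambda>x. h (c * x)) \<in> borel_measurable lebesgue" "(\<lambda>x. h (x * c)) \<in> borel_measurable lebesgue"
  using measurable_compose[OF lebesgue_measurable_scaling[of c] assms]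
  by (simp_all add: mult.commute)

lemma integral_lebesgue_scale:
  fixes h :: "real \<Rightarrow> real"
  assumes h: "h \<in> borel_measurable lebesgue" and c: "c > 0"
  shows "(\<integral>x. h x \<partial>lebesgue) = c * (\<integral>x. h (c * x) \<partial>lebesgue)"
proof -
  have m: "(\<lambda>x. c * x) \<in> lebesgue \<rightarrow>\<^sub>M lebesgue"
    using lebesgue_measurable_scaling[where 'a = real, of c] by (simp add: real_scaleR_def[abs_def])
  have "(\<integral>x. h x \<partial>lebesgue)
      = (\<integral>x. h x \<partial>density (distr lebesgue lebesgue (\<lambda>x. c * x)) (\<lambda>x. ennreal \<bar>c\<bar>))"
    using lebesgue_real_scale[of c] c by simp
  also have "\<dots> = (\<integral>x. \<bar>c\<bar> * h x \<partial>distr lebesgue lebesgue (\<lambda>x. c * x))"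
    using h by (subst integral_density) auto
  also have "\<dots> = (\<integral>x. \<bar>c\<bar> * h (c * x) \<partial>lebesgue)"
    using h m by (subst integral_distr) auto
  finally show ?thesis using c by simp
qed

lemma slowly_varying_nonzero:
  fixes L :: "real \<Rightarrow> real"
  assumes sv: "\<And>c. c > 0 \<Longrightarrow> ((\<lambda>s. L (c * s) / L s) \<longlongrightarrow> 1) (at_right 0)"
  shows "\<forall>\<^sub>F s in at_right 0. L s \<noteq> 0"
proof -
  have "\<forall>\<^sub>F s in at_right 0. L (1 * s) / L s > 0"
    using order_tendstoD(1)[OF sv[of 1], of 0] by simp
  then show ?thesis by eventually_elim auto
qed

text \<open>
  A bounded pseudometric on the nonzero reals. Being bounded, it can be integrated by dominated convergence; being
  blind to signs, it lets the argument work for a function whose sign is not known at every point.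
\<close>

definition log_dist :: "real \<Rightarrow> real \<Rightarrow> real" where
  "log_dist p q = min 1 \<bar>ln \<bar>p\<bar> - ln \<bar>q\<bar>\<bar>"

lemma log_dist_measurable [measurable (raw)]:
  assumes [measurable]: "p \<in> borel_measurable M" "q \<in> borel_measurable M"
  shows "(\<lambda>x. log_dist (p x) (q x)) \<in> borel_measurable M"
  unfolding log_dist_def by measurable

lemma log_dist_bounds: "0 \<le> log_dist p q" "log_dist p q \<le> 1"
  by (auto simp: log_dist_def)

lemma log_dist_triangle: "log_dist p q \<le> log_dist r p + log_dist r q"
proof -
  have min_add: "min 1 a \<le> min 1 b + min 1 c" if "a \<le> b + c" "0 \<le> b" "0 \<le> c" for a b c :: real
    using that by (auto simp: min_def)
  show ?thesis
    unfolding log_dist_def by (rule min_add) linarith+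
qed

lemma slowly_varying_log_dist:
  fixes L :: "real \<Rightarrow> real"
  assumes sv: "\<And>c. c > 0 \<Longrightarrow> ((\<lambda>s. L (c * s) / L s) \<longlongrightarrow> 1) (at_right 0)" and c: "c > 0"
  shows "((\<lambda>s. log_dist (L (c * s)) (L s)) \<longlongrightarrow> 0) (at_right 0)"
proof (rule Lim_null_comparison)
  have "((\<lambda>s. ln \<bar>L (c * s) / L s\<bar>) \<longlongrightarrow> ln \<bar>1\<bar>) (at_right 0)"
    using sv[OF c] by (intro tendsto_intros) auto
  then show "((\<lambda>s. \<bar>ln \<bar>L (c * s) / L s\<bar>\<bar>) \<longlongrightarrow> 0) (at_right 0)"
    by (simp add: tendsto_rabs_zero)
  have "\<forall>\<^sub>F s in at_right 0. L (c * s) / L s > 0"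
    using order_tendstoD(1)[OF sv[OF c], of 0] by simp
  then show "\<forall>\<^sub>F s in at_right 0. norm (log_dist (L (c * s)) (L s)) \<le> \<bar>ln \<bar>L (c * s) / L s\<bar>\<bar>"
  proof eventually_elim
    case (elim s)
    then have "L (c * s) \<noteq> 0" "L s \<noteq> 0" by auto
    then have "ln \<bar>L (c * s) / L s\<bar> = ln \<bar>L (c * s)\<bar> - ln \<bar>L s\<bar>"
      by (simp add: abs_divide ln_div)
    then show ?case by (simp add: log_dist_def)
  qed
qed

text \<open>
  The oscillation of \<open>ln \<bar>L\<bar>\<close> over \<open>[s, 2 s]\<close> is controlled by an average: with
  \<open>\<Phi> s\<close> the integral of \<open>log_dist (L (c * s)) (L s)\<close> over \<open>c \<in> [1, 4]\<close>, dominated convergence gives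
  \<open>\<Phi> s \<rightarrow> 0\<close>. For \<open>a \<in> [1, 2]\<close> the windows \<open>[s, 4 s]\<close> and \<open>[a s, 4 a s]\<close> share \<open>[2 s, 4 s]\<close>, and the triangle
  inequality integrated over the common part compares \<open>L (a * s)\<close> with \<open>L s\<close> through \<open>\<Phi> s\<close> and \<open>\<Phi> (a * s)\<close>
  only. This bound is uniform in \<open>a\<close>.
\<close>

lemma slowly_varying_uniform:
  fixes L :: "real \<Rightarrow> real"
  assumes L: "L \<in> borel_measurable lebesgue"
    and sv: "\<And>c. c > 0 \<Longrightarrow> ((\<lambda>s. L (c * s) / L s) \<longlongrightarrow> 1) (at_right 0)" and e: "e > 0"
  shows "\<exists>s0>0. \<forall>s a. 0 < s \<and> s \<le> s0 \<and> 1 \<le> a \<and> a \<le> 2 \<longrightarrow> \<bar>ln \<bar>L (a * s)\<bar> - ln \<bar>L s\<bar>\<bar> < e"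
proof -
  define D where "D s c = indicator {1..4} c * log_dist (L (c * s)) (L s)" for s c :: real
  define \<Phi> where "\<Phi> s = (\<integral>c. D s c \<partial>lebesgue)" for s
  have Lscale [measurable]: "(\<lambda>c. L (c * s)) \<in> borel_measurable lebesgue" for s
    by (rule measurable_lebesgue_mult[OF L])
  have ind_m: "(indicator {a..b} :: real \<Rightarrow> real) \<in> borel_measurable lebesgue" for a b :: real
    by (auto intro!: measurable_completion)
  have D_m [measurable]: "D s \<in> borel_measurable lebesgue" for s
    unfolding D_def using ind_m by (intro borel_measurable_times log_dist_measurable) auto
  have D_bd: "\<bar>D s c\<bar> \<le> indicator {1..4} c" "0 \<le> D s c" for s c
    using log_dist_bounds by (auto simp: D_def indicator_def)
  have ind_int: "integrable lebesgue (indicator {a..b} :: real \<Rightarrow> real)" for a b :: real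
    using integrable_real_indicator[of "{a..b}" lborel]
    by (simp add: integrable_completion emeasure_lborel_Icc_eq)
  have D_int: "integrable lebesgue (D s)" for s
    using ind_int[of 1 4] by (rule Bochner_Integration.integrable_bound) (use D_bd in auto)
  have "((\<lambda>x. \<Phi> (inverse x)) \<longlongrightarrow> (\<integral>c. (0::real) \<partial>(lebesgue :: real measure))) at_top"
    unfolding \<Phi>_def
  proof (rule integral_dominated_convergence_at_top[where w = "indicator {1..4}"])
    show "AE c in lebesgue. ((\<lambda>x. D (inverse x) c) \<longlongrightarrow> 0) at_top"
    proof (rule AE_I2)
      fix c :: real
      show "((\<lambda>x. D (inverse x) c) \<longlongrightarrow> 0) at_top"
      proof (cases "c \<in> {1..4}")
        case True
        then have "((\<lambda>s. D s c) \<longlongrightarrow> 0) (at_right 0)"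
          using slowly_varying_log_dist[OF sv, of c] by (simp add: D_def)
        then show ?thesis by (simp add: filterlim_at_right_to_top)
      qed (simp add: D_def)
    qed
  qed (use D_bd ind_int in auto)
  then have "(\<Phi> \<longlongrightarrow> 0) (at_right 0)"
    by (simp add: filterlim_at_right_to_top)
  moreover define \<epsilon> where "\<epsilon> = min 1 e / 3"
  ultimately have "\<forall>\<^sub>F s in at_right 0. \<Phi> s < \<epsilon>"
    using e by (intro order_tendstoD) auto
  then obtain b where b: "b > 0" "\<And>s. 0 < s \<Longrightarrow> s < b \<Longrightarrow> \<Phi> s < \<epsilon>"
    by (auto simp: eventually_at_right[of 0 "1::real"])
  have key: "2 * log_dist (L (a * s)) (L s) \<le> \<Phi> s + 2 * \<Phi> (a * s)"
    if s: "0 < s" and a: "1 \<le> a" "a \<le> 2" for s a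
  proof -
    \<comment> \<open>The window of a * s, written in the variable of the window of s.\<close>
    let ?E = "\<lambda>c. indicator {a..4*a} c * log_dist (L (c * s)) (L (a * s))"
    have E_m: "?E \<in> borel_measurable lebesgue"
      using ind_m by (intro borel_measurable_times log_dist_measurable) auto
    have E_int: "integrable lebesgue ?E"
      using ind_int[of a "4*a"] E_m
      by (rule Bochner_Integration.integrable_bound) (auto simp: indicator_def log_dist_bounds)
    have "(\<integral>c. ?E c \<partial>lebesgue) = a * (\<integral>c. ?E (a * c) \<partial>lebesgue)"
      using integral_lebesgue_scale[OF E_m, of a] a by simp
    also have "(\<lambda>c. ?E (a * c)) = D (a * s)"
      using a by (auto simp: D_def indicator_def fun_eq_iff mult_ac)
    finally have E: "(\<integral>c. ?E c \<partial>lebesgue) = a * \<Phi> (a * s)" by (simp add: \<Phi>_def)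
    have "\<Phi> (a * s) \<ge> 0" unfolding \<Phi>_def using D_bd by (intro integral_nonneg_AE) auto
    then have a_le: "a * \<Phi> (a * s) \<le> 2 * \<Phi> (a * s)" using a by (intro mult_right_mono) auto
    have "2 * log_dist (L (a * s)) (L s)
        = (\<integral>c. indicator {2..4} c * log_dist (L (a * s)) (L s) \<partial>(lebesgue :: real measure))"
      by (simp add: integral_completion)
    also have "\<dots> \<le> (\<integral>c. D s c + ?E c \<partial>lebesgue)"
    proof (rule integral_mono)
      show "indicator {2..4} c * log_dist (L (a * s)) (L s) \<le> D s c + ?E c" for c :: real
        using a log_dist_triangle[of "L (a * s)" "L s" "L (c * s)"] log_dist_bounds
        by (auto simp: D_def indicator_def)
    qed (use ind_int D_int E_int in auto)
    also have "\<dots> = \<Phi> s + a * \<Phi> (a * s)"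
      using D_int E_int by (simp add: E \<Phi>_def)
    also have "\<dots> \<le> \<Phi> s + 2 * \<Phi> (a * s)" using a_le by simp
    finally show ?thesis .
  qed
  show ?thesis
  proof (intro exI[of _ "b / 3"] conjI allI impI)
    show "b / 3 > 0" using b by simp
    fix s a :: real assume sa: "0 < s \<and> s \<le> b / 3 \<and> 1 \<le> a \<and> a \<le> 2"
    have "a * s \<le> 2 * (b / 3)" using sa by (intro mult_mono) auto
    then have "a * s < b" using b by linarith
    moreover have "0 < a * s" using sa by simp
    ultimately have "\<Phi> (a * s) < \<epsilon>" "\<Phi> s < \<epsilon>" using b sa by auto
    with key[of s a] sa have "2 * log_dist (L (a * s)) (L s) < 3 * \<epsilon>" by simp
    then have "log_dist (L (a * s)) (L s) < min 1 e"
      using log_dist_bounds(1)[of "L (a * s)" "L s"] by (auto simp: \<epsilon>_def min_def split: if_splits)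
    then show "\<bar>ln \<bar>L (a * s)\<bar> - ln \<bar>L s\<bar>\<bar> < e"
      by (auto simp: log_dist_def min_def split: if_splits)
  qed
qed

section \<open>Potter bounds and an Abelian theorem\<close>

text \<open>
  By uniform convergence \<open>ln \<bar>L\<bar>\<close> changes by less than \<open>d * ln 2\<close> over each dyadic step below \<open>s1\<close>.
  Between two arguments with ratio \<open>r \<ge> 1\<close> there are at most \<open>log 2 r + 1\<close> such steps, so
  \<open>ln \<bar>L\<bar>\<close> changes by at most \<open>d * ln r + d * ln 2\<close>.
\<close>

lemma slowly_varying_potter:
  fixes L :: "real \<Rightarrow> real"
  assumes L: "L \<in> borel_measurable lebesgue"
    and sv: "\<And>c. c > 0 \<Longrightarrow> ((\<lambda>s. L (c * s) / L s) \<longlongrightarrow> 1) (at_right 0)" and d: "d > 0"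
  shows "\<exists>s0>0. \<exists>A>0. \<forall>s s'. 0 < s \<and> s \<le> s0 \<and> 0 < s' \<and> s' \<le> s0 \<longrightarrow>
    L s \<noteq> 0 \<and> \<bar>L s' / L s\<bar> \<le> A * ((s' / s) powr d + (s' / s) powr (- d))"
proof -
  define e where "e = d * ln 2"
  have e: "e > 0" using d by (simp add: e_def)
  obtain s1 where s1: "s1 > 0"
    and unif: "\<And>s a. 0 < s \<Longrightarrow> s \<le> s1 \<Longrightarrow> 1 \<le> a \<Longrightarrow> a \<le> 2 \<Longrightarrow> \<bar>ln \<bar>L (a * s)\<bar> - ln \<bar>L s\<bar>\<bar> < e"
    using slowly_varying_uniform[OF L sv e] by blast
  obtain b where b: "b > 0" "\<And>s. 0 < s \<Longrightarrow> s < b \<Longrightarrow> L s \<noteq> 0"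
    using slowly_varying_nonzero[OF sv] by (auto simp: eventually_at_right[of 0 "1::real"])
  define s0 where "s0 = min s1 (b / 2)"
  have s0: "s0 > 0" "s0 \<le> s1" "s0 < b" using s1 b by (auto simp: s0_def)
  have chain: "\<bar>ln \<bar>L s'\<bar> - ln \<bar>L s\<bar>\<bar> \<le> real n * e"
    if "0 < s" "s \<le> s'" "s' \<le> 2 ^ n * s" "s' \<le> s0" for n s s'
    using that
  proof (induction n arbitrary: s')
    case 0
    then have "s' = s" by simp
    then show ?case by simp
  next
    case (Suc n)
    show ?case
    proof (cases "s' \<le> 2 * s")
      case True
      have "\<bar>ln \<bar>L (s' / s * s)\<bar> - ln \<bar>L s\<bar>\<bar> < e"
        using Suc.prems True s0 by (intro unif) (auto simp: field_simps)
      then have "\<bar>ln \<bar>L s'\<bar> - ln \<bar>L s\<bar>\<bar> \<le> 1 * e" using Suc.prems by simp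
      also have "\<dots> \<le> real (Suc n) * e" using e by (intro mult_right_mono) auto
      finally show ?thesis .
    next
      case False
      have "\<bar>ln \<bar>L (s' / 2)\<bar> - ln \<bar>L s\<bar>\<bar> \<le> real n * e"
        using Suc.prems False by (intro Suc.IH) auto
      moreover have "\<bar>ln \<bar>L s'\<bar> - ln \<bar>L (s' / 2)\<bar>\<bar> < e"
        using unif[of "s' / 2" 2] Suc.prems s0 by simp
      ultimately have "\<bar>ln \<bar>L s'\<bar> - ln \<bar>L s\<bar>\<bar> \<le> real n * e + e"
        by linarith
      then show ?thesis by (simp add: algebra_simps)
    qed
  qed
  have log_bound: "\<bar>ln \<bar>L s'\<bar> - ln \<bar>L s\<bar>\<bar> \<le> d * ln 2 + d * ln (s' / s)"
    if s: "0 < s" "s \<le> s'" "s' \<le> s0" for s s'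
  proof -
    define n where "n = nat \<lceil>log 2 (s' / s)\<rceil>"
    have ge: "log 2 (s' / s) \<ge> 0" using s by simp
    then have n: "log 2 (s' / s) \<le> real n" "real n \<le> log 2 (s' / s) + 1"
      unfolding n_def by linarith+
    have "s' / s = 2 powr log 2 (s' / s)" using s by simp
    also have "\<dots> \<le> 2 powr real n" using n by (intro powr_mono) auto
    finally have "s' \<le> 2 ^ n * s" using s by (simp add: powr_realpow field_simps)
    then have "\<bar>ln \<bar>L s'\<bar> - ln \<bar>L s\<bar>\<bar> \<le> real n * e" using s by (intro chain) auto
    also have "\<dots> \<le> (log 2 (s' / s) + 1) * e" using n e by (intro mult_right_mono) auto
    also have "\<dots> = d * ln 2 + d * ln (s' / s)" by (simp add: e_def log_def field_simps)
    finally show ?thesis .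
  qed
  have ratio: "L s \<noteq> 0 \<and> \<bar>L s' / L s\<bar> \<le> 2 powr d * ((s' / s) powr d + (s' / s) powr (- d))"
    if s: "0 < s \<and> s \<le> s0 \<and> 0 < s' \<and> s' \<le> s0" for s s'
  proof
    have nz: "L s \<noteq> 0" "L s' \<noteq> 0" using s s0 b by auto
    show "L s \<noteq> 0" by fact
    have "ln \<bar>L s'\<bar> - ln \<bar>L s\<bar> \<le> d * ln 2 + d * \<bar>ln (s' / s)\<bar>"
    proof (cases "s \<le> s'")
      case True
      then show ?thesis using log_bound[of s s'] s by simp
    next
      case False
      then have "ln (s' / s) = - ln (s / s')" "ln (s / s') \<ge> 0" using s by (simp_all add: ln_div)
      then show ?thesis using log_bound[of s' s] s False by simp
    qed
    also have "ln \<bar>L s'\<bar> - ln \<bar>L s\<bar> = ln \<bar>L s' / L s\<bar>"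
      using nz by (simp add: abs_divide ln_div)
    finally have "exp (ln \<bar>L s' / L s\<bar>) \<le> exp (d * ln 2 + d * \<bar>ln (s' / s)\<bar>)" by simp
    also have "exp (ln \<bar>L s' / L s\<bar>) = \<bar>L s' / L s\<bar>" using nz by simp
    also have "exp (d * ln 2 + d * \<bar>ln (s' / s)\<bar>) = 2 powr d * exp (d * \<bar>ln (s' / s)\<bar>)"
      by (simp add: exp_add powr_def)
    also have "\<dots> \<le> 2 powr d * ((s' / s) powr d + (s' / s) powr (- d))"
      using s by (intro mult_left_mono) (auto simp: powr_def abs_if)
    finally show "\<bar>L s' / L s\<bar> \<le> 2 powr d * ((s' / s) powr d + (s' / s) powr (- d))" .
  qed
  have "(2::real) powr d > 0" by simp
  with ratio s0(1) show ?thesis by blast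
qed

lemma Gamma_integral_scaled:
  fixes a c :: real
  assumes a: "a > 0" and c: "c > 0"
  shows "has_bochner_integral lebesgue (\<lambda>y. indicator {0<..} y * (y powr (a - 1) * exp (- (c * y))))
    (Gamma a / c powr a)"
proof -
  have "has_bochner_integral lborel (\<lambda>t. indicator {0..} t * t powr (a - 1) / exp t) (Gamma a)"
    using Gamma_conv_nn_integral_real[OF a] Gamma_real_pos[OF a]
    by (intro has_bochner_integral_nn_integral) auto
  then have "has_bochner_integral lborel (\<lambda>t. indicator {0..} (0 + c * t) * (0 + c * t) powr (a - 1) / exp (0 + c * t))
    (Gamma a /\<^sub>R \<bar>c\<bar>)"
    using c by (subst (asm) lborel_has_bochner_integral_real_affine_iff[of c _ _ 0]) auto
  then have "has_bochner_integral lborel (\<lambda>t. (1 / c powr (a - 1)) *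
      (indicator {0..} (0 + c * t) * (0 + c * t) powr (a - 1) / exp (0 + c * t)))
    ((1 / c powr (a - 1)) * (Gamma a /\<^sub>R \<bar>c\<bar>))"
    by (intro has_bochner_integral_mult_right) auto
  also have "(1 / c powr (a - 1)) * (Gamma a /\<^sub>R \<bar>c\<bar>) = Gamma a / c powr a"
    using c by (simp add: powr_diff field_simps)
  also have "(\<lambda>t. (1 / c powr (a - 1)) *
      (indicator {0..} (0 + c * t) * (0 + c * t) powr (a - 1) / exp (0 + c * t)))
    = (\<lambda>y. indicator {0<..} y * (y powr (a - 1) * exp (- (c * y))))"
    using c by (auto simp: fun_eq_iff indicator_def powr_mult exp_minus field_simps zero_le_mult_iff)
  finally show ?thesis
    by (auto simp: has_bochner_integral_iff integrable_completion integral_completion)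
qed

text \<open>
  After the substitution \<open>y = x s\<close> the left-hand side is the integral of
  \<open>y powr (\<beta> - 1) * (L (y / x) / L (1 / x)) * k x (y / x)\<close> over \<open>0 < y < x\<close>. The ratio tends to \<open>1\<close> for each \<open>y\<close>,
  and a Potter bound with exponent \<open>d < \<beta>\<close> keeps the integrand below a combination of two Gamma integrands.
  For a Laplace kernel \<open>k x s = exp (- c x s)\<close> this is Karamata's Abelian theorem at the origin.
\<close>

lemma abelian_slowly_varying:
  fixes L K :: "real \<Rightarrow> real" and k :: "real \<Rightarrow> real \<Rightarrow> real"
  assumes L: "L \<in> borel_measurable lebesgue"
    and sv: "\<And>c. c > 0 \<Longrightarrow> ((\<lambda>s. L (c * s) / L s) \<longlongrightarrow> 1) (at_right 0)"
    and L_bd: "\<And>b. 0 < b \<Longrightarrow> \<exists>B. \<forall>s\<in>{b..1}. \<bar>L s\<bar> \<le> B"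
    and \<beta>: "\<beta> > 0" and c: "c > 0"
    and k: "\<And>x. k x \<in> borel_measurable lebesgue" and K: "K \<in> borel_measurable lebesgue"
    and k_bd: "\<And>x s. x > 0 \<Longrightarrow> 0 < s \<Longrightarrow> s < 1 \<Longrightarrow> \<bar>k x s\<bar> \<le> C * exp (- (c * (x * s)))"
    and k_lim: "\<And>y. y > 0 \<Longrightarrow> ((\<lambda>x. k x (y / x)) \<longlongrightarrow> K y) at_top"
  shows "((\<lambda>x. x powr \<beta> / L (1 / x) *
            (\<integral>s. indicator {0<..<1} s * (s powr (\<beta> - 1) * L s * k x s) \<partial>lebesgue))
    \<longlongrightarrow> (\<integral>y. indicator {0<..} y * (y powr (\<beta> - 1) * K y) \<partial>lebesgue)) at_top"
proof -
  define d where "d = \<beta> / 2"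
  have d: "d > 0" "\<beta> - d > 0" using \<beta> by (auto simp: d_def)
  obtain s0 A where s0: "s0 > 0" and A: "A > 0"
    and potter: "\<And>s s'. 0 < s \<Longrightarrow> s \<le> s0 \<Longrightarrow> 0 < s' \<Longrightarrow> s' \<le> s0 \<Longrightarrow>
      L s \<noteq> 0 \<and> \<bar>L s' / L s\<bar> \<le> A * ((s' / s) powr d + (s' / s) powr (- d))"
    using slowly_varying_potter[OF L sv d(1)] by blast
  obtain B where B: "\<And>s. s0 \<le> s \<Longrightarrow> s \<le> 1 \<Longrightarrow> \<bar>L s\<bar> \<le> B"
    using L_bd[OF s0] by (auto simp: Ball_def)
  define A' where "A' = max A (\<bar>B\<bar> / \<bar>L s0\<bar> * (2 * A))"
  define x0 where "x0 = 1 / s0"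
  have x0: "x0 > 0" using s0 by (simp add: x0_def)
  have L_ratio: "\<bar>L (y / x) / L (1 / x)\<bar> \<le> A' * (y powr d + y powr (- d))"
    if x: "x \<ge> x0" and y: "0 < y" "y < x" for x y
  proof -
    have x_pos: "x > 0" using x x0 by linarith
    then have inv: "0 < 1 / x" "1 / x \<le> s0"
      using x s0 by (auto simp: x0_def field_simps)
    show ?thesis
    \<comment> \<open>Potter bounds only reach up to s0. Beyond it L is bounded, and there y is at least s0 * x, so that 1 / L (1 / x) is at most of order y powr d.\<close>
    proof (cases "y / x \<le> s0")
      case True
      have "\<bar>L (y / x) / L (1 / x)\<bar> \<le> A * ((y / x / (1 / x)) powr d + (y / x / (1 / x)) powr (- d))"
        using potter[of "1 / x" "y / x"] True y inv x_pos by auto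
      also have "y / x / (1 / x) = y" using x_pos by simp
      also have "A * (y powr d + y powr (- d)) \<le> A' * (y powr d + y powr (- d))"
        by (intro mult_right_mono) (auto simp: A'_def)
      finally show ?thesis .
    next
      case False
      have nz: "L s0 \<noteq> 0" using potter[of s0 s0] s0 by auto
      have sx: "1 \<le> s0 * x" using x s0 by (auto simp: x0_def field_simps)
      have sxy: "s0 * x \<le> y" using False x_pos by (auto simp: field_simps)
      have "\<bar>L s0 / L (1 / x)\<bar> \<le> A * ((s0 * x) powr d + (s0 * x) powr (- d))"
        using potter[of "1 / x" s0] inv s0 x_pos by auto
      also have "\<dots> \<le> A * (y powr d + y powr d)"
      proof (intro mult_left_mono add_mono)
        show 1: "(s0 * x) powr d \<le> y powr d" using sx sxy d by (intro powr_mono2) auto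
        have "(s0 * x) powr (- d) \<le> (s0 * x) powr d" using sx d by (intro powr_mono) auto
        then show "(s0 * x) powr (- d) \<le> y powr d" using 1 by linarith
      qed (use A in auto)
      finally have r: "\<bar>L s0 / L (1 / x)\<bar> \<le> 2 * A * y powr d" by simp
      have "\<bar>L (y / x)\<bar> \<le> \<bar>B\<bar>" using B[of "y / x"] False y x_pos by (auto simp: field_simps)
      then have "\<bar>L (y / x)\<bar> / \<bar>L s0\<bar> * \<bar>L s0 / L (1 / x)\<bar> \<le> \<bar>B\<bar> / \<bar>L s0\<bar> * (2 * A * y powr d)"
        using r A by (intro mult_mono divide_right_mono) auto
      also have "\<bar>L (y / x)\<bar> / \<bar>L s0\<bar> * \<bar>L s0 / L (1 / x)\<bar> = \<bar>L (y / x) / L (1 / x)\<bar>"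
        using nz by (simp add: abs_divide)
      also have "\<bar>B\<bar> / \<bar>L s0\<bar> * (2 * A * y powr d) = (\<bar>B\<bar> / \<bar>L s0\<bar> * (2 * A)) * y powr d" by simp
      also have "\<dots> \<le> A' * (y powr d + y powr (- d))"
        using A by (intro mult_mono) (auto simp: A'_def)
      finally show ?thesis .
    qed
  qed
  define F where "F x y = indicator {0<..<x} y * (y powr (\<beta> - 1) * (L (y / x) / L (1 / x)) * k x (y / x))"
    for x y :: real
  define w where "w y = A' * C * (indicator {0<..} y * (y powr (\<beta> + d - 1) * exp (- (c * y)))
    + indicator {0<..} y * (y powr (\<beta> - d - 1) * exp (- (c * y))))" for y :: real
  \<comment> \<open>Any admissible argument serves here; the kernel bound forces the sign of C.\<close>
  have C: "C \<ge> 0"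
  proof -
    have "0 \<le> C * exp (- (c * (1 * (1 / 2))))" using k_bd[of 1 "1/2"] by linarith
    then show ?thesis by (simp add: zero_le_mult_iff)
  qed
  have w_int: "integrable lebesgue w"
    unfolding w_def using Gamma_integral_scaled[of "\<beta> + d" c] Gamma_integral_scaled[of "\<beta> - d" c] d \<beta> c
    by (intro integrable_mult_right Bochner_Integration.integrable_add)
      (auto simp: has_bochner_integral_iff)
  have borel_leb: "h \<in> borel_measurable borel \<Longrightarrow> h \<in> borel_measurable lebesgue" for h :: "real \<Rightarrow> real"
    by (simp add: measurable_completion)
  have F_m: "F x \<in> borel_measurable lebesgue" for x
    unfolding F_def
    using measurable_lebesgue_mult[OF L, of "1 / x"] measurable_lebesgue_mult[OF k[of x], of "1 / x"]
    by (intro borel_measurable_times borel_measurable_divide) (auto intro!: borel_leb)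
  have F_bd: "\<bar>F x y\<bar> \<le> w y" if x: "x \<ge> x0" for x y
  proof (cases "y \<in> {0<..<x}")
    case True
    then have y: "0 < y" "y < x" and x_pos: "x > 0" by auto
    have kb: "\<bar>k x (y / x)\<bar> \<le> C * exp (- (c * y))"
      using k_bd[of x "y / x"] y x_pos by simp
    have "\<bar>F x y\<bar> = y powr (\<beta> - 1) * (\<bar>L (y / x) / L (1 / x)\<bar> * \<bar>k x (y / x)\<bar>)"
      using True by (simp add: F_def abs_mult)
    also have "\<dots> \<le> y powr (\<beta> - 1) * ((A' * (y powr d + y powr (- d))) * (C * exp (- (c * y))))"
      using L_ratio[OF x y] kb A by (intro mult_left_mono mult_mono) (auto simp: A'_def)
    also have "\<dots> = w y"
      using y by (simp add: w_def powr_add powr_diff powr_minus field_simps)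
    finally show ?thesis .
  next
    case False
    then show ?thesis using A C by (auto simp: F_def w_def A'_def le_max_iff_disj)
  qed
  have F_lim: "((\<lambda>x. F x y) \<longlongrightarrow> indicator {0<..} y * (y powr (\<beta> - 1) * K y)) at_top" for y
  proof (cases "y > 0")
    case True
    have inv: "filterlim (\<lambda>x::real. 1 / x) (at_right 0) at_top"
      using filterlim_inverse_at_right_top by (simp add: inverse_eq_divide)
    have "((\<lambda>x. y powr (\<beta> - 1) * (L (y * (1 / x)) / L (1 / x)) * k x (y / x))
        \<longlongrightarrow> y powr (\<beta> - 1) * 1 * K y) at_top"
      by (intro tendsto_mult tendsto_const k_lim True filterlim_compose[OF sv[OF True] inv])
    moreover have "\<forall>\<^sub>F x in at_top. y powr (\<beta> - 1) * (L (y * (1 / x)) / L (1 / x)) * k x (y / x) = F x y"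
      using eventually_gt_at_top[of y] by eventually_elim (use True in \<open>simp add: F_def\<close>)
    ultimately show ?thesis
      using True by (auto intro: Lim_transform_eventually)
  qed (simp add: F_def)
  have "((\<lambda>x. \<integral>y. F x y \<partial>lebesgue) \<longlongrightarrow> (\<integral>y. indicator {0<..} y * (y powr (\<beta> - 1) * K y) \<partial>lebesgue)) at_top"
  proof (rule integral_dominated_convergence_at_top[where w = w])
    show "(\<lambda>y. indicator {0<..} y * (y powr (\<beta> - 1) * K y)) \<in> borel_measurable lebesgue"
      using K by (intro borel_measurable_times) (auto intro!: borel_leb)
    show "\<forall>\<^sub>F x in at_top. AE y in lebesgue. norm (F x y) \<le> w y"
      using eventually_ge_at_top[of x0] by eventually_elim (use F_bd in auto)
  qed (use F_m F_lim w_int in auto)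
  moreover have "\<forall>\<^sub>F x in at_top. (\<integral>y. F x y \<partial>lebesgue) = x powr \<beta> / L (1 / x) *
      (\<integral>s. indicator {0<..<1} s * (s powr (\<beta> - 1) * L s * k x s) \<partial>lebesgue)"
    using eventually_gt_at_top[of 0]
  proof eventually_elim
    case (elim x)
    have "(\<integral>y. F x y \<partial>lebesgue) = x * (\<integral>s. F x (x * s) \<partial>lebesgue)"
      by (rule integral_lebesgue_scale[OF F_m elim])
    also have "(\<lambda>s. F x (x * s)) = (\<lambda>s. (x powr (\<beta> - 1) / L (1 / x)) *
        (indicator {0<..<1} s * (s powr (\<beta> - 1) * L s * k x s)))"
      using elim by (auto simp: F_def fun_eq_iff indicator_def powr_mult zero_less_mult_iff)
    also have "x * (\<integral>s. (x powr (\<beta> - 1) / L (1 / x)) *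
          (indicator {0<..<1} s * (s powr (\<beta> - 1) * L s * k x s)) \<partial>lebesgue)
      = x * x powr (\<beta> - 1) / L (1 / x) *
          (\<integral>s. indicator {0<..<1} s * (s powr (\<beta> - 1) * L s * k x s) \<partial>lebesgue)"
      by (simp only: integral_mult_right_zero) simp
    also have "x * x powr (\<beta> - 1) = x powr \<beta>"
      using elim by (simp add: powr_diff)
    finally show ?case .
  qed
  ultimately show ?thesis by (rule Lim_transform_eventually)
qed

section \<open>Pathwise description of the total time\<close>

text \<open>
  Describes the event \<open>X > x\<close> by countably many conditions on finitely many failure times each, with the failure
  times themselves as data. This makes the event measurable and shows that it depends on \<open>T\<close> and on the sequence
  of failure times only, which is what conditioning on \<open>T\<close> requires. An infinite \<open>restart_N\<close> makes the right-hand side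
  vacuous.
\<close>

lemma restart_X_gt_iff:
  "restart_X \<tau> V \<omega> > ereal x \<longleftrightarrow>
    (\<forall>n. V (Suc n) \<omega> > \<tau> \<omega> \<longrightarrow> (\<forall>i<n. V (Suc i) \<omega> \<le> \<tau> \<omega>) \<longrightarrow> x < \<tau> \<omega> + (\<Sum>i<n. V (Suc i) \<omega>))"
proof (cases "\<exists>n. V (Suc n) \<omega> > \<tau> \<omega>")
  case False
  then have "restart_N \<tau> V \<omega> = \<infinity>" by (simp add: restart_N_def top_enat_def)
  then show ?thesis using False by (simp add: restart_X_def)
next
  case True
  define N where "N = (LEAST n. V (Suc n) \<omega> > \<tau> \<omega>)"
  have N: "V (Suc N) \<omega> > \<tau> \<omega>" unfolding N_def using True by (rule LeastI_ex)
  have N_le: "N \<le> n" if "V (Suc n) \<omega> > \<tau> \<omega>" for n unfolding N_def using that by (rule Least_le)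
  have "restart_N \<tau> V \<omega> = enat N"
    unfolding restart_N_def by (rule antisym) (use N N_le in \<open>auto intro!: Inf_lower Inf_greatest\<close>)
  then have X: "restart_X \<tau> V \<omega> = ereal (\<tau> \<omega> + (\<Sum>i<N. V (Suc i) \<omega>))"
    by (simp add: restart_X_def sum.atLeast1_atMost_eq)
  have first: "V (Suc n) \<omega> > \<tau> \<omega> \<and> (\<forall>i<n. V (Suc i) \<omega> \<le> \<tau> \<omega>) \<longleftrightarrow> n = N" for n
    using N N_le by (metis leD leI le_neq_implies_less order.antisym)
  show ?thesis unfolding X less_ereal.simps using first by metis
qed

text \<open>
  If one of the first \<open>n\<close> failure times exceeds \<open>t\<close>, then the run ends after fewer than \<open>n\<close> failures. The failure times
  that count are then at most \<open>t\<close>, which is why the truncated sum already bounds the elapsed time.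
\<close>

lemma restart_X_gt_upper:
  assumes V: "\<And>i. V (Suc i) \<omega> \<ge> 0" and "restart_X (\<lambda>_. t) V \<omega> > ereal x"
  shows "(\<forall>i<n. V (Suc i) \<omega> \<le> t) \<or> x < t + (\<Sum>i<n. if V (Suc i) \<omega> \<le> t then V (Suc i) \<omega> else 0)"
proof (rule disjCI)
  let ?W = "\<lambda>i. if V (Suc i) \<omega> \<le> t then V (Suc i) \<omega> else 0"
  assume "\<not> x < t + sum ?W {..<n}"
  show "\<forall>i<n. V (Suc i) \<omega> \<le> t"
  proof (rule ccontr)
    assume "\<not> (\<forall>i<n. V (Suc i) \<omega> \<le> t)"
    then have ex: "\<exists>i. V (Suc i) \<omega> > t \<and> i < n" by (auto simp: not_le)
    define k where "k = (LEAST i. V (Suc i) \<omega> > t)"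
    have k: "V (Suc k) \<omega> > t" unfolding k_def using ex by (metis LeastI)
    have below: "V (Suc i) \<omega> \<le> t" if "i < k" for i
      using not_less_Least[of i "\<lambda>i. V (Suc i) \<omega> > t"] that by (auto simp: k_def not_less)
    have "k < n" using ex unfolding k_def by (meson Least_le le_less_trans)
    have "x < t + (\<Sum>i<k. V (Suc i) \<omega>)"
      using assms(2) k below by (auto simp: restart_X_gt_iff)
    also have "(\<Sum>i<k. V (Suc i) \<omega>) = sum ?W {..<k}" using below by (intro sum.cong) auto
    also have "\<dots> \<le> sum ?W {..<n}" using \<open>k < n\<close> V by (intro sum_mono2) auto
    finally show False using \<open>\<not> x < t + sum ?W {..<n}\<close> by simp
  qed
qed

lemma restart_X_gt_lower:
  assumes V: "\<And>i. V (Suc i) \<omega> \<ge> 0" and t: "t \<ge> 0"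
    and "\<forall>i<n. V (Suc i) \<omega> \<le> t" and "x < (\<Sum>i<n. V (Suc i) \<omega>)"
  shows "restart_X (\<lambda>_. t) V \<omega> > ereal x"
  unfolding restart_X_gt_iff
proof (intro allI impI)
  fix N assume "t < V (Suc N) \<omega>"
  then have "n \<le> N" using assms(3) by (meson leI not_less)
  then have "(\<Sum>i<n. V (Suc i) \<omega>) \<le> (\<Sum>i<N. V (Suc i) \<omega>)" using V by (intro sum_mono2) auto
  then show "x < t + (\<Sum>i<N. V (Suc i) \<omega>)" using assms(4) t by simp
qed

section \<open>The total time of a task of fixed length\<close>

lemma power_one_minus_tendsto_exp:
  fixes p :: "real \<Rightarrow> real" and n :: "real \<Rightarrow> nat"
  assumes p: "(p \<longlongrightarrow> 0) F" and p0: "\<And>x. 0 \<le> p x" and np: "((\<lambda>x. real (n x) * p x) \<longlongrightarrow> a) F"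
  shows "((\<lambda>x. (1 - p x) ^ n x) \<longlongrightarrow> exp (- a)) F"
proof -
  have half: "\<forall>\<^sub>F x in F. p x < 1 / 2" by (rule order_tendstoD(2)[OF p]) simp
  have "((\<lambda>x. - (real (n x) * p x) - 2 * (real (n x) * p x) * p x) \<longlongrightarrow> - a - 2 * a * 0) F"
    by (intro tendsto_intros np p)
  then have low: "((\<lambda>x. - (real (n x) * p x) - 2 * (real (n x) * p x) * p x) \<longlongrightarrow> - a) F" by simp
  have up: "((\<lambda>x. - (real (n x) * p x)) \<longlongrightarrow> - a) F"
    by (intro tendsto_intros np)
  have "((\<lambda>x. real (n x) * ln (1 - p x)) \<longlongrightarrow> - a) F"
  proof (rule tendsto_sandwich[OF _ _ low up])
    show "\<forall>\<^sub>F x in F. - (real (n x) * p x) - 2 * (real (n x) * p x) * p x \<le> real (n x) * ln (1 - p x)"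
      using half
    proof eventually_elim
      case (elim x)
      have "- p x - 2 * (p x)\<^sup>2 \<le> ln (1 - p x)"
        using p0[of x] elim by (intro ln_one_minus_pos_lower_bound) auto
      then have "real (n x) * (- p x - 2 * (p x)\<^sup>2) \<le> real (n x) * ln (1 - p x)"
        by (rule mult_left_mono) simp
      then show ?case by (simp add: power2_eq_square algebra_simps)
    qed
    show "\<forall>\<^sub>F x in F. real (n x) * ln (1 - p x) \<le> - (real (n x) * p x)"
      using half
    proof eventually_elim
      case (elim x)
      have "ln (1 - p x) \<le> - p x" using ln_add_one_self_le_self2[of "- p x"] elim by simp
      then have "real (n x) * ln (1 - p x) \<le> real (n x) * (- p x)" by (rule mult_left_mono) simp
      then show ?case by simp
    qed
  qed
  then have "((\<lambda>x. exp (real (n x) * ln (1 - p x))) \<longlongrightarrow> exp (- a)) F" by (rule tendsto_exp)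
  moreover have "\<forall>\<^sub>F x in F. exp (real (n x) * ln (1 - p x)) = (1 - p x) ^ n x"
    using half by eventually_elim (simp add: exp_of_nat_mult)
  ultimately show ?thesis by (rule Lim_transform_eventually)
qed

lemma nat_floor_mult_over_tendsto:
  fixes \<kappa> :: real
  assumes "\<kappa> \<ge> 0"
  shows "((\<lambda>x. real (nat \<lfloor>\<kappa> * x\<rfloor>) / x) \<longlongrightarrow> \<kappa>) at_top"
proof (rule tendsto_sandwich)
  have inv: "((\<lambda>x::real. 1 / x) \<longlongrightarrow> 0) at_top"
    using tendsto_inverse_0_at_top[OF filterlim_ident] by (simp add: inverse_eq_divide)
  have "((\<lambda>x. \<kappa> - 1 / x) \<longlongrightarrow> \<kappa> - 0) at_top" by (intro tendsto_intros inv)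
  then show "((\<lambda>x. \<kappa> - 1 / x) \<longlongrightarrow> \<kappa>) at_top" by simp
  show "\<forall>\<^sub>F x in at_top. \<kappa> - 1 / x \<le> real (nat \<lfloor>\<kappa> * x\<rfloor>) / x"
    using eventually_gt_at_top[of 0]
  proof eventually_elim
    case (elim x)
    have "\<kappa> * x - 1 \<le> real (nat \<lfloor>\<kappa> * x\<rfloor>)" by linarith
    then have "(\<kappa> * x - 1) / x \<le> real (nat \<lfloor>\<kappa> * x\<rfloor>) / x" using elim by (intro divide_right_mono) auto
    then show ?case using elim by (simp add: field_simps)
  qed
  show "\<forall>\<^sub>F x in at_top. real (nat \<lfloor>\<kappa> * x\<rfloor>) / x \<le> \<kappa>"
    using eventually_gt_at_top[of 0]
  proof eventually_elim
    case (elim x)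
    have "0 \<le> \<kappa> * x" using elim assms by simp
    then have "real (nat \<lfloor>\<kappa> * x\<rfloor>) \<le> \<kappa> * x" by linarith
    then show ?case using elim by (simp add: field_simps)
  qed
qed auto

context restart_model
begin

(* Keeps the generic failure time in the form U 1 under simplification. *)
declare One_nat_def [simp del]

definition restart_tail :: "real \<Rightarrow> real \<Rightarrow> real" where
  "restart_tail x t = tail_prob M (restart_X (\<lambda>_. t) U) (ereal x)"

abbreviation "G_tail \<equiv> tail_prob M (U 1)"
abbreviation "mean \<equiv> expectation (U 1)"

lemma T_measurable [measurable]: "T \<in> borel_measurable M"
  using T_density by (simp add: has_density_nonneg_def distributed_def)

lemma U_measurable [measurable]: "U (Suc i) \<in> borel_measurable M"
  using U_density[of "Suc i"] by (simp add: has_density_nonneg_def distributed_def)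

lemma U1_measurable [measurable]: "U 1 \<in> borel_measurable M" "U (Suc 0) \<in> borel_measurable M"
  using U_measurable[of 0] by (simp_all add: One_nat_def)

lemma distr_lborel_eq: "distr M lborel X = distr M borel X"
  by (rule distr_cong) auto

lemma distr_U: "distr M borel (U (Suc i)) = distr M borel (U 1)"
proof -
  have "distr M lborel (U (Suc i)) = distr M lborel (U 1)"
    using U_density[of "Suc i"] U_density[of 1] by (simp add: has_density_nonneg_def distributed_def)
  then show ?thesis by (simp add: distr_lborel_eq)
qed

lemma U_AE_nonneg: "AE \<omega> in M. \<forall>i. U (Suc i) \<omega> \<ge> 0"
  using U_nonneg by (simp add: AE_all_countable)

text \<open>
  The form in which independence and identical distribution of the failure times are used: probabilities with
  indicators as \<open>\<phi>\<close>, exponential moments with exponentials.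
\<close>

lemma nn_integral_prod_U:
  fixes \<phi> :: "real \<Rightarrow> ennreal"
  assumes [measurable]: "\<phi> \<in> borel_measurable borel"
  shows "(\<integral>\<^sup>+\<omega>. (\<Prod>i<n. \<phi> (U (Suc i) \<omega>)) \<partial>M) = (\<integral>\<^sup>+\<omega>. \<phi> (U 1 \<omega>) \<partial>M) ^ n"
proof -
  have "indep_vars (\<lambda>_. borel) (\<lambda>n::nat. if n = 0 then T else U n) {1..n}"
    using T_U_indep by (rule indep_vars_subset) simp
  then have "indep_vars (\<lambda>_. borel) U {1..n}"
    by (rule iffD1[OF indep_vars_cong, rotated 3]) auto
  then have "indep_vars (\<lambda>_. borel) (\<lambda>i \<omega>. \<phi> (U i \<omega>)) {1..n}"
    by (rule indep_vars_compose2) simp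
  then have "(\<integral>\<^sup>+\<omega>. (\<Prod>i=1..n. \<phi> (U i \<omega>)) \<partial>M) = (\<Prod>i=1..n. \<integral>\<^sup>+\<omega>. \<phi> (U i \<omega>) \<partial>M)"
    by (intro indep_vars_nn_integral) auto
  then have "(\<integral>\<^sup>+\<omega>. (\<Prod>i<n. \<phi> (U (Suc i) \<omega>)) \<partial>M) = (\<Prod>i<n. \<integral>\<^sup>+\<omega>. \<phi> (U (Suc i) \<omega>) \<partial>M)"
    by (simp add: prod.atLeast1_atMost_eq One_nat_def)
  also have "\<dots> = (\<Prod>i<n. \<integral>\<^sup>+\<omega>. \<phi> (U 1 \<omega>) \<partial>M)"
  proof (rule prod.cong)
    fix i
    show "(\<integral>\<^sup>+\<omega>. \<phi> (U (Suc i) \<omega>) \<partial>M) = (\<integral>\<^sup>+\<omega>. \<phi> (U 1 \<omega>) \<partial>M)"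
      using nn_integral_distr[of "U (Suc i)" M borel \<phi>] nn_integral_distr[of "U 1" M borel \<phi>] distr_U[of i]
      by simp
  qed simp
  finally show ?thesis by simp
qed

lemma restart_event_measurable [measurable]:
  "{\<omega> \<in> space M. restart_X (\<lambda>_. t) U \<omega> > ereal x} \<in> sets M"
  "{\<omega> \<in> space M. restart_X T U \<omega> > ereal x} \<in> sets M"
  unfolding restart_X_gt_iff by measurable

lemma restart_tail_bounds: "0 \<le> restart_tail x t" "restart_tail x t \<le> 1"
  by (auto simp: restart_tail_def tail_prob_def)

lemma G_tail_bounds: "0 \<le> G_tail t" "G_tail t \<le> 1"
  by (auto simp: tail_prob_def)

lemma prob_no_long_failure: "prob {\<omega> \<in> space M. \<forall>i<n. U (Suc i) \<omega> \<le> t} = (1 - G_tail t) ^ n"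
proof -
  have "prob {\<omega> \<in> space M. U 1 \<omega> \<le> t} = 1 - G_tail t"
    unfolding tail_prob_def by (subst prob_compl[symmetric]) (auto intro!: arg_cong[where f = prob])
  then have one: "(\<integral>\<^sup>+\<omega>. indicator {..t} (U 1 \<omega>) \<partial>M) = ennreal (1 - G_tail t)"
    by (subst nn_integral_indicator'[symmetric] nn_integral_cong[where v = "indicator {\<omega> \<in> space M. U 1 \<omega> \<le> t}"])
      (auto simp: indicator_def emeasure_eq_measure)
  have "ennreal (prob {\<omega> \<in> space M. \<forall>i<n. U (Suc i) \<omega> \<le> t})
      = (\<integral>\<^sup>+\<omega>. indicator {\<omega> \<in> space M. \<forall>i<n. U (Suc i) \<omega> \<le> t} \<omega> \<partial>M)"
    by (simp add: emeasure_eq_measure)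
  also have "\<dots> = (\<integral>\<^sup>+\<omega>. (\<Prod>i<n. indicator {..t} (U (Suc i) \<omega>)) \<partial>M)"
    by (intro nn_integral_cong) (auto simp: indicator_def prod_zero_iff)
  also have "\<dots> = ennreal ((1 - G_tail t) ^ n)"
    using G_tail_bounds by (simp add: nn_integral_prod_U one ennreal_power)
  finally show ?thesis using G_tail_bounds by (simp add: ennreal_inj)
qed

lemma chernoff_U:
  fixes \<psi> :: "real \<Rightarrow> real"
  assumes [measurable]: "\<psi> \<in> borel_measurable borel"
    and b: "(\<integral>\<^sup>+\<omega>. ennreal (exp (\<psi> (U 1 \<omega>))) \<partial>M) \<le> ennreal b" "b \<ge> 0"
  shows "prob {\<omega> \<in> space M. a \<le> (\<Sum>i<n. \<psi> (U (Suc i) \<omega>))} \<le> exp (- a) * b ^ n"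
proof -
  have "ennreal (prob {\<omega> \<in> space M. a \<le> (\<Sum>i<n. \<psi> (U (Suc i) \<omega>))})
      = (\<integral>\<^sup>+\<omega>. indicator {\<omega> \<in> space M. a \<le> (\<Sum>i<n. \<psi> (U (Suc i) \<omega>))} \<omega> \<partial>M)"
    by (simp add: emeasure_eq_measure)
  also have "\<dots> \<le> (\<integral>\<^sup>+\<omega>. ennreal (exp (- a)) * (\<Prod>i<n. ennreal (exp (\<psi> (U (Suc i) \<omega>)))) \<partial>M)"
    by (intro nn_integral_mono)
      (auto simp: indicator_def prod_ennreal exp_sum[symmetric] ennreal_mult[symmetric] exp_add[symmetric]
        simp flip: ennreal_1 intro!: ennreal_leI)
  also have "\<dots> = ennreal (exp (- a)) * (\<integral>\<^sup>+\<omega>. ennreal (exp (\<psi> (U 1 \<omega>))) \<partial>M) ^ n"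
    by (simp add: nn_integral_cmult nn_integral_prod_U[where \<phi> = "\<lambda>u. ennreal (exp (\<psi> u))"])
  also have "\<dots> \<le> ennreal (exp (- a)) * ennreal b ^ n"
    by (intro mult_left_mono power_mono b) auto
  also have "\<dots> = ennreal (exp (- a) * b ^ n)"
    using b by (simp add: ennreal_power ennreal_mult)
  finally show ?thesis using b by (simp add: ennreal_le_iff)
qed

text \<open>
  Truncation at \<open>t\<close> makes \<open>exp z \<le> 1 + z * exp z\<close>, with \<open>z = \<theta> u \<le> \<theta> t\<close>, a bound that is linear in \<open>u\<close>, so a first moment
  of \<open>U 1\<close> suffices.
\<close>

lemma truncated_exp_moment:
  assumes \<theta>: "\<theta> \<ge> 0" and t: "t \<ge> 0"
  shows "(\<integral>\<^sup>+\<omega>. ennreal (exp (\<theta> * (if U 1 \<omega> \<le> t then U 1 \<omega> else 0))) \<partial>M)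
    \<le> ennreal (exp (\<theta> * exp (\<theta> * t) * mean))"
proof -
  have pt: "exp (\<theta> * (if u \<le> t then u else 0)) \<le> 1 + \<theta> * exp (\<theta> * t) * u" if u: "u \<ge> 0" for u
  proof (cases "u \<le> t")
    case True
    define z where "z = \<theta> * u"
    have z: "0 \<le> z" "z \<le> \<theta> * t" using u \<theta> True by (auto simp: z_def mult_left_mono)
    have "1 - z \<le> exp (- z)" using exp_ge_add_one_self[of "- z"] by simp
    then have "exp z * (1 - z) \<le> exp z * exp (- z)" by (intro mult_left_mono) auto
    then have "exp z \<le> 1 + z * exp z" by (simp add: exp_minus algebra_simps)
    also have "\<dots> \<le> 1 + z * exp (\<theta> * t)" using z by (simp add: mult_left_mono)
    finally show ?thesis using True by (simp add: z_def mult_ac)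
  qed (use u \<theta> in simp)
  have "(\<integral>\<^sup>+\<omega>. ennreal (exp (\<theta> * (if U 1 \<omega> \<le> t then U 1 \<omega> else 0))) \<partial>M)
      \<le> (\<integral>\<^sup>+\<omega>. ennreal (1 + \<theta> * exp (\<theta> * t) * U 1 \<omega>) \<partial>M)"
    using U_nonneg[OF order_refl]
    by (intro nn_integral_mono_AE, eventually_elim) (intro ennreal_leI pt)
  also have "\<dots> = ennreal (\<integral>\<omega>. 1 + \<theta> * exp (\<theta> * t) * U 1 \<omega> \<partial>M)"
  proof (rule nn_integral_eq_integral)
    show "AE \<omega> in M. 0 \<le> 1 + \<theta> * exp (\<theta> * t) * U 1 \<omega>"
      using U_nonneg[OF order_refl] by eventually_elim (use \<theta> in simp)
  qed (use U_integrable in auto)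
  also have "(\<integral>\<omega>. 1 + \<theta> * exp (\<theta> * t) * U 1 \<omega> \<partial>M) = 1 + \<theta> * exp (\<theta> * t) * mean"
    using U_integrable by (simp add: prob_space)
  also have "ennreal \<dots> \<le> ennreal (exp (\<theta> * exp (\<theta> * t) * mean))"
    using exp_ge_add_one_self by (intro ennreal_leI) auto
  finally show ?thesis .
qed

text \<open>
  The parameters \<open>\<theta>\<close> and \<open>n\<close> are free: \<open>\<theta> = G_tail t\<close> yields the uniform exponential bound, and
  \<open>\<theta> = \<delta> / t\<close> the sharp upper limit.
\<close>

lemma restart_tail_upper:
  assumes \<theta>: "\<theta> \<ge> 0" and t: "t \<ge> 0"
  shows "restart_tail x t
    \<le> (1 - G_tail t) ^ n + exp (- (\<theta> * (x - t))) * exp (\<theta> * exp (\<theta> * t) * mean) ^ n"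
proof -
  let ?W = "\<lambda>u. if u \<le> t then u else 0"
  let ?A = "{\<omega> \<in> space M. \<forall>i<n. U (Suc i) \<omega> \<le> t}"
  let ?B = "{\<omega> \<in> space M. \<theta> * (x - t) \<le> (\<Sum>i<n. \<theta> * ?W (U (Suc i) \<omega>))}"
  have "restart_tail x t \<le> prob (?A \<union> ?B)"
    unfolding restart_tail_def tail_prob_def
  proof (rule finite_measure_mono_AE)
    show "AE \<omega> in M. \<omega> \<in> {\<omega> \<in> space M. ereal x < restart_X (\<lambda>_. t) U \<omega>} \<longrightarrow> \<omega> \<in> ?A \<union> ?B"
      using U_AE_nonneg
    proof eventually_elim
      case (elim \<omega>)
      show ?case
      proof safe
        assume \<omega>: "\<omega> \<in> space M" "ereal x < restart_X (\<lambda>_. t) U \<omega>"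
          "\<not> \<theta> * (x - t) \<le> (\<Sum>i<n. \<theta> * ?W (U (Suc i) \<omega>))"
        fix i assume "i < n"
        have "\<not> x < t + (\<Sum>i<n. ?W (U (Suc i) \<omega>))"
        proof
          assume "x < t + (\<Sum>i<n. ?W (U (Suc i) \<omega>))"
          then have "\<theta> * (x - t) \<le> \<theta> * (\<Sum>i<n. ?W (U (Suc i) \<omega>))"
            using \<theta> by (intro mult_left_mono) auto
          then show False using \<omega>(3) by (simp add: sum_distrib_left)
        qed
        then show "U (Suc i) \<omega> \<le> t"
          using restart_X_gt_upper[of U \<omega> x t n] elim \<omega>(2) \<open>i < n\<close> by auto
      qed
    qed
  qed measurable
  also have "\<dots> \<le> prob ?A + prob ?B" by (rule measure_Un_le) measurable
  also have "prob ?A = (1 - G_tail t) ^ n" by (rule prob_no_long_failure)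
  also have "prob ?B \<le> exp (- (\<theta> * (x - t))) * exp (\<theta> * exp (\<theta> * t) * mean) ^ n"
    using truncated_exp_moment[OF \<theta> t] by (intro chernoff_U) auto
  finally show ?thesis by simp
qed

text \<open>
  If the first \<open>n\<close> failure times all stay below \<open>t\<close> and add up to more than \<open>x\<close>, then \<open>X > x\<close>. The second
  requirement fails with small probability, by a Chernoff bound with negative exponent, for which nonnegative variables need
  no further moments.
\<close>

lemma restart_tail_lower:
  assumes \<theta>: "\<theta> > 0" and t: "t \<ge> 0"
    and b: "expectation (\<lambda>\<omega>. exp (- (\<theta> * U 1 \<omega>))) \<le> b"
  shows "(1 - G_tail t) ^ n - exp (\<theta> * x) * b ^ n \<le> restart_tail x t"
proof -
  let ?A = "{\<omega> \<in> space M. \<forall>i<n. U (Suc i) \<omega> \<le> t}"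
  let ?B = "{\<omega> \<in> space M. - (\<theta> * x) \<le> (\<Sum>i<n. - (\<theta> * U (Suc i) \<omega>))}"
  let ?H = "{\<omega> \<in> space M. ereal x < restart_X (\<lambda>_. t) U \<omega>}"
  have "prob ?A \<le> prob (?H \<union> ?B)"
  proof (rule finite_measure_mono_AE)
    show "AE \<omega> in M. \<omega> \<in> ?A \<longrightarrow> \<omega> \<in> ?H \<union> ?B"
      using U_AE_nonneg
    proof eventually_elim
      case (elim \<omega>)
      show ?case
      proof safe
        assume \<omega>: "\<omega> \<in> space M" "\<forall>i<n. U (Suc i) \<omega> \<le> t" "\<not> - (\<theta> * x) \<le> (\<Sum>i<n. - (\<theta> * U (Suc i) \<omega>))"
        have "x < (\<Sum>i<n. U (Suc i) \<omega>)"
        proof (rule ccontr)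
          assume "\<not> ?thesis"
          then have "\<theta> * (\<Sum>i<n. U (Suc i) \<omega>) \<le> \<theta> * x" using \<theta> by (intro mult_left_mono) auto
          then show False using \<omega>(3) by (simp add: sum_distrib_left sum_negf)
        qed
        then show "ereal x < restart_X (\<lambda>_. t) U \<omega>"
          using restart_X_gt_lower[of U \<omega> t n x] elim t \<omega> by auto
      qed
    qed
  qed measurable
  also have "\<dots> \<le> prob ?H + prob ?B" by (rule measure_Un_le) measurable
  also have "prob ?B \<le> exp (- (- (\<theta> * x))) * b ^ n"
  proof (rule chernoff_U)
    have int: "integrable M (\<lambda>\<omega>. exp (- (\<theta> * U 1 \<omega>)))"
      using U_nonneg[of 1] \<theta>
      by (intro integrable_const_bound[where B = 1]) (auto elim!: eventually_mono)
    have "(\<integral>\<^sup>+\<omega>. ennreal (exp (- (\<theta> * U 1 \<omega>))) \<partial>M) = ennreal (expectation (\<lambda>\<omega>. exp (- (\<theta> * U 1 \<omega>))))"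
      using int by (intro nn_integral_eq_integral) auto
    then show "(\<integral>\<^sup>+\<omega>. ennreal (exp (- (\<theta> * U 1 \<omega>))) \<partial>M) \<le> ennreal b"
      using b by (simp add: ennreal_leI)
    have "0 \<le> expectation (\<lambda>\<omega>. exp (- (\<theta> * U 1 \<omega>)))" by (intro integral_nonneg_AE) auto
    then show "b \<ge> 0" using b by linarith
  qed measurable
  finally show ?thesis
    by (simp add: prob_no_long_failure restart_tail_def tail_prob_def)
qed


lemma G_tail_antimono: "s \<le> t \<Longrightarrow> G_tail t \<le> G_tail s"
  unfolding tail_prob_def by (intro finite_measure_mono) auto

lemma integrable_tail_indicator:
  "integrable M (\<lambda>\<omega>. t * indicator {\<omega> \<in> space M. t < U 1 \<omega>} \<omega>)"
  "integrable M (\<lambda>\<omega>. indicator {\<omega> \<in> space M. t < U 1 \<omega>} \<omega> * U 1 \<omega>)"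
proof -
  have A: "{\<omega> \<in> space M. t < U 1 \<omega>} \<in> events" by measurable
  show "integrable M (\<lambda>\<omega>. t * indicator {\<omega> \<in> space M. t < U 1 \<omega>} \<omega>)"
    using A by (intro integrable_mult_right integrable_real_indicator) (auto simp: less_top[symmetric])
  show "integrable M (\<lambda>\<omega>. indicator {\<omega> \<in> space M. t < U 1 \<omega>} \<omega> * U 1 \<omega>)"
    using integrable_real_mult_indicator[OF A U_integrable] by (simp add: mult.commute)
qed

lemma mult_G_tail_le_mean:
  assumes t: "t \<ge> 0"
  shows "t * G_tail t \<le> mean"
proof -
  have "t * G_tail t = (\<integral>\<omega>. t * indicator {\<omega> \<in> space M. t < U 1 \<omega>} \<omega> \<partial>M)"
    by (simp add: tail_prob_def)
  also have "\<dots> \<le> mean"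
  proof (rule integral_mono_AE[OF integrable_tail_indicator(1) U_integrable])
    show "AE \<omega> in M. t * indicator {\<omega> \<in> space M. t < U 1 \<omega>} \<omega> \<le> U 1 \<omega>"
      using U_nonneg[OF order_refl] by eventually_elim (auto simp: indicator_def)
  qed
  finally show ?thesis .
qed

text \<open>
  Integrability of \<open>U 1\<close> makes the tail of its expectation vanish. This is what lets the task length \<open>t\<close> be neglected
  against \<open>x\<close> when \<open>x\<close> is of order \<open>1 / G_tail t\<close>.
\<close>

lemma mult_G_tail_tendsto_0: "((\<lambda>t. t * G_tail t) \<longlongrightarrow> 0) at_top"
proof (rule tendsto_sandwich[where f = "\<lambda>_. 0"])
  show "\<forall>\<^sub>F t in at_top. t * G_tail t \<le> (\<integral>\<omega>. indicator {\<omega> \<in> space M. t < U 1 \<omega>} \<omega> * U 1 \<omega> \<partial>M)"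
    using eventually_ge_at_top[of 0]
  proof eventually_elim
    case (elim t)
    have "t * G_tail t = (\<integral>\<omega>. t * indicator {\<omega> \<in> space M. t < U 1 \<omega>} \<omega> \<partial>M)"
      by (simp add: tail_prob_def)
    also have "\<dots> \<le> (\<integral>\<omega>. indicator {\<omega> \<in> space M. t < U 1 \<omega>} \<omega> * U 1 \<omega> \<partial>M)"
      by (rule integral_mono[OF integrable_tail_indicator]) (auto simp: indicator_def)
    finally show ?case .
  qed
  have "((\<lambda>t. \<integral>\<omega>. indicator {\<omega> \<in> space M. t < U 1 \<omega>} \<omega> * U 1 \<omega> \<partial>M) \<longlongrightarrow> (\<integral>\<omega>. 0 \<partial>M)) at_top"
  proof (rule integral_dominated_convergence_at_top[where w = "\<lambda>\<omega>. \<bar>U 1 \<omega>\<bar>"])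
    show "AE \<omega> in M. ((\<lambda>t. indicator {\<omega> \<in> space M. t < U 1 \<omega>} \<omega> * U 1 \<omega>) \<longlongrightarrow> 0) at_top"
    proof (rule AE_I2)
      fix \<omega>
      have "\<forall>\<^sub>F t in at_top. indicator {\<omega> \<in> space M. t < U 1 \<omega>} \<omega> * U 1 \<omega> = 0"
        using eventually_ge_at_top[of "U 1 \<omega>"] by eventually_elim auto
      then show "((\<lambda>t. indicator {\<omega> \<in> space M. t < U 1 \<omega>} \<omega> * U 1 \<omega>) \<longlongrightarrow> 0) at_top"
        by (rule tendsto_eventually)
    qed
  qed (use U_integrable in \<open>auto simp: indicator_def\<close>)
  then show "((\<lambda>t. \<integral>\<omega>. indicator {\<omega> \<in> space M. t < U 1 \<omega>} \<omega> * U 1 \<omega> \<partial>M) \<longlongrightarrow> 0) at_top"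
    by simp
  show "\<forall>\<^sub>F t in at_top. 0 \<le> t * G_tail t"
    using eventually_ge_at_top[of 0] by eventually_elim (simp add: G_tail_bounds)
qed auto

text \<open>
  The difference quotients \<open>(1 - exp (- \<theta> u)) / \<theta>\<close> are dominated by \<open>u\<close> and tend to it as \<open>\<theta> \<rightarrow> 0\<close>.
\<close>

lemma laplace_below_mean:
  assumes b: "b < mean"
  shows "\<exists>\<theta>>0. expectation (\<lambda>\<omega>. exp (- (\<theta> * U 1 \<omega>))) \<le> 1 - \<theta> * b"
proof -
  define \<theta> where "\<theta> n = 1 / real (Suc n)" for n
  have \<theta>: "\<theta> n > 0" for n by (simp add: \<theta>_def)
  have \<theta>_lim: "\<theta> \<longlonglongrightarrow> 0"
    unfolding \<theta>_def by (rule LIMSEQ_Suc[OF lim_1_over_n])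
  have "(\<lambda>n. \<integral>\<omega>. (1 - exp (- (\<theta> n * U 1 \<omega>))) / \<theta> n \<partial>M) \<longlonglongrightarrow> mean"
  proof (rule integral_dominated_convergence[where w = "\<lambda>\<omega>. \<bar>U 1 \<omega>\<bar>"])
    show "AE \<omega> in M. (\<lambda>n. (1 - exp (- (\<theta> n * U 1 \<omega>))) / \<theta> n) \<longlonglongrightarrow> U 1 \<omega>"
    proof (rule AE_I2)
      fix \<omega>
      have "((\<lambda>h. - exp (- (h * U 1 \<omega>))) has_real_derivative U 1 \<omega>) (at 0)"
        by (auto intro!: derivative_eq_intros)
      then have "((\<lambda>h. (1 - exp (- (h * U 1 \<omega>))) / h) \<longlongrightarrow> U 1 \<omega>) (at 0)"
        by (simp add: DERIV_def)
      then show "(\<lambda>n. (1 - exp (- (\<theta> n * U 1 \<omega>))) / \<theta> n) \<longlonglongrightarrow> U 1 \<omega>"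
        by (rule filterlim_compose) (use \<theta> \<theta>_lim in \<open>auto simp: filterlim_at intro!: always_eventually less_imp_neq[symmetric]\<close>)
    qed
    show "AE \<omega> in M. norm ((1 - exp (- (\<theta> n * U 1 \<omega>))) / \<theta> n) \<le> \<bar>U 1 \<omega>\<bar>" for n
      using U_nonneg[OF order_refl]
    proof eventually_elim
      case (elim \<omega>)
      have "0 \<le> 1 - exp (- (\<theta> n * U 1 \<omega>))" "1 - exp (- (\<theta> n * U 1 \<omega>)) \<le> \<theta> n * U 1 \<omega>"
        using elim \<theta>[of n] exp_ge_add_one_self[of "- (\<theta> n * U 1 \<omega>)"] by auto
      then show ?case using elim \<theta>[of n] by (simp add: divide_simps mult.commute)
    qed
  qed (use U_integrable in auto)
  then have "\<forall>\<^sub>F n in sequentially. b < (\<integral>\<omega>. (1 - exp (- (\<theta> n * U 1 \<omega>))) / \<theta> n \<partial>M)"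
    using b by (rule order_tendstoD)
  then obtain n where n: "b < (\<integral>\<omega>. (1 - exp (- (\<theta> n * U 1 \<omega>))) / \<theta> n \<partial>M)"
    by (auto simp: eventually_sequentially)
  have int: "integrable M (\<lambda>\<omega>. exp (- (\<theta> n * U 1 \<omega>)))"
    using U_nonneg[OF order_refl]
    by (intro integrable_const_bound[where B = 1], eventually_elim) (use \<theta>[of n] in auto)
  have "(\<integral>\<omega>. 1 - exp (- (\<theta> n * U 1 \<omega>)) \<partial>M) = 1 - expectation (\<lambda>\<omega>. exp (- (\<theta> n * U 1 \<omega>)))"
    using Bochner_Integration.integral_diff[OF integrable_const int, of 1] by (simp add: prob_space)
  with n have "b < (1 - expectation (\<lambda>\<omega>. exp (- (\<theta> n * U 1 \<omega>)))) / \<theta> n"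
    by (simp only: integral_divide_zero)
  then have "expectation (\<lambda>\<omega>. exp (- (\<theta> n * U 1 \<omega>))) \<le> 1 - \<theta> n * b"
    using \<theta>[of n] by (simp add: field_simps)
  then show ?thesis using \<theta> by blast
qed

text \<open>
  In \<open>restart_tail_upper\<close> take \<open>\<theta> = p\<close> and \<open>n\<close> about \<open>\<kappa> x\<close>. As \<open>p t \<le> mean\<close> by Markov's inequality,
  the exponents that come from the task length are at most \<open>mean\<close>, and \<open>\<kappa> = exp (- mean) / (2 * mean)\<close> is the value
  for which the truncated moments use up exactly half of the gain \<open>exp (- p x)\<close>.
\<close>

lemma restart_tail_exp_bound:
  assumes mean: "mean > 0" and t: "t \<ge> 0" and x: "x \<ge> 0"
  shows "restart_tail x t \<le> (exp 1 + exp mean) * exp (- (min (exp (- mean) / (2 * mean)) (1 / 2) * (x * G_tail t)))"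
proof -
  define p where "p = G_tail t"
  define \<kappa> where "\<kappa> = exp (- mean) / (2 * mean)"
  define c where "c = min \<kappa> (1 / 2)"
  define n where "n = nat \<lfloor>\<kappa> * x\<rfloor>"
  have p: "0 \<le> p" "p \<le> 1" using G_tail_bounds by (auto simp: p_def)
  have \<kappa>: "\<kappa> > 0" using mean by (simp add: \<kappa>_def)
  have "0 \<le> \<kappa> * x" using \<kappa> x by simp
  then have n: "\<kappa> * x - 1 \<le> real n" "real n \<le> \<kappa> * x" unfolding n_def by linarith+
  have pt: "p * t \<le> mean" using mult_G_tail_le_mean[OF t] by (simp add: p_def mult.commute)
  have c_le: "c * (x * p) \<le> \<kappa> * (x * p)" "c * (x * p) \<le> 1 / 2 * (x * p)"
    using p x by (intro mult_right_mono; simp add: c_def)+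
  have "restart_tail x t \<le> (1 - p) ^ n + exp (- (p * (x - t))) * exp (p * exp (p * t) * mean) ^ n"
    using restart_tail_upper[OF p(1) t, of x n] by (simp add: p_def)
  moreover have "(1 - p) ^ n \<le> exp 1 * exp (- (c * (x * p)))"
  proof -
    have "(1 - p) ^ n \<le> exp (- p) ^ n"
      using p exp_ge_add_one_self[of "- p"] by (intro power_mono) auto
    also have "\<dots> = exp (- (real n * p))" by (simp add: exp_of_nat_mult[symmetric])
    also have "\<dots> \<le> exp (1 - c * (x * p))"
    proof -
      have "(\<kappa> * x - 1) * p \<le> real n * p" using n p by (intro mult_right_mono) auto
      then have "\<kappa> * (x * p) - p \<le> real n * p" by (simp add: algebra_simps)
      then show ?thesis using c_le p by simp
    qed
    finally show ?thesis by (simp add: exp_diff exp_minus field_simps)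
  qed
  moreover have "exp (- (p * (x - t))) * exp (p * exp (p * t) * mean) ^ n \<le> exp mean * exp (- (c * (x * p)))"
  proof -
    have "real n * (p * exp (p * t) * mean) \<le> (\<kappa> * x) * (p * exp mean * mean)"
      using n p pt mean x \<kappa> by (intro mult_mono) auto
    also have "\<dots> = 1 / 2 * (x * p)" using mean by (simp add: \<kappa>_def exp_minus field_simps)
    finally have "- (p * (x - t)) + real n * (p * exp (p * t) * mean) \<le> mean - c * (x * p)"
      using c_le pt by (simp add: algebra_simps)
    then have "exp (- (p * (x - t)) + real n * (p * exp (p * t) * mean)) \<le> exp (mean + - (c * (x * p)))"
      by simp
    then show ?thesis by (simp only: exp_add exp_of_nat_mult)
  qed
  ultimately show ?thesis by (simp add: c_def \<kappa>_def p_def algebra_simps)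
qed

lemma no_failure_limit:
  assumes \<kappa>: "\<kappa> \<ge> 0" and xp: "((\<lambda>x. x * G_tail (\<tau> x)) \<longlongrightarrow> y) at_top"
  shows "((\<lambda>x. (1 - G_tail (\<tau> x)) ^ nat \<lfloor>\<kappa> * x\<rfloor>) \<longlongrightarrow> exp (- (\<kappa> * y))) at_top"
proof (rule power_one_minus_tendsto_exp)
  have "((\<lambda>x. x * G_tail (\<tau> x) / x) \<longlongrightarrow> 0) at_top"
    by (rule tendsto_divide_0[OF xp]) (auto intro: filterlim_at_top_imp_at_infinity filterlim_ident)
  moreover have "\<forall>\<^sub>F x in at_top. x * G_tail (\<tau> x) / x = G_tail (\<tau> x)"
    using eventually_gt_at_top[of 0] by eventually_elim simp
  ultimately show "((\<lambda>x. G_tail (\<tau> x)) \<longlongrightarrow> 0) at_top" by (rule Lim_transform_eventually)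
  have "((\<lambda>x. real (nat \<lfloor>\<kappa> * x\<rfloor>) / x * (x * G_tail (\<tau> x))) \<longlongrightarrow> \<kappa> * y) at_top"
    by (intro tendsto_mult nat_floor_mult_over_tendsto \<kappa> xp)
  moreover have "\<forall>\<^sub>F x in at_top. real (nat \<lfloor>\<kappa> * x\<rfloor>) / x * (x * G_tail (\<tau> x))
      = real (nat \<lfloor>\<kappa> * x\<rfloor>) * G_tail (\<tau> x)"
    using eventually_gt_at_top[of 0] by eventually_elim simp
  ultimately show "((\<lambda>x. real (nat \<lfloor>\<kappa> * x\<rfloor>) * G_tail (\<tau> x)) \<longlongrightarrow> \<kappa> * y) at_top"
    by (rule Lim_transform_eventually)
qed (rule G_tail_bounds)

text \<open>
  A law of large numbers in disguise. With \<open>\<kappa> x\<close> failure times, the probability that none exceeds \<open>\<tau> x\<close> tends to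
  \<open>exp (- \<kappa> y)\<close>. For \<open>\<kappa> < 1 / mean\<close> their truncated sum stays below \<open>x - \<tau> x\<close>, for
  \<open>\<kappa> > 1 / mean\<close> their sum exceeds \<open>x\<close>, in both cases up to an event of vanishing probability, and letting \<open>\<kappa> \<rightarrow> 1 / mean\<close> from both sides identifies
  the limit.
\<close>

lemma restart_tail_limit:
  assumes mean: "mean > 0" and \<tau>: "filterlim \<tau> at_top at_top" and \<tau>x: "((\<lambda>x. \<tau> x / x) \<longlongrightarrow> 0) at_top"
    and xp: "((\<lambda>x. x * G_tail (\<tau> x)) \<longlongrightarrow> y) at_top"
  shows "((\<lambda>x. restart_tail x (\<tau> x)) \<longlongrightarrow> exp (- (y / mean))) at_top"
proof -
  have cont: "((\<lambda>\<kappa>. exp (- (\<kappa> * y))) \<longlongrightarrow> exp (- (1 / mean * y))) (at (1 / mean) within S)" for S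
    by (intro tendsto_intros)
  have \<tau>_pos: "\<forall>\<^sub>F x in at_top. \<tau> x > 0" using \<tau> by (simp add: filterlim_at_top_dense)
  show ?thesis
  proof (rule order_tendstoI)
    fix a assume a: "exp (- (y / mean)) < a"
    have "\<forall>\<^sub>F \<kappa> in at_left (1 / mean). exp (- (\<kappa> * y)) < a"
      using a by (intro order_tendstoD(2)[OF cont]) simp
    moreover have "\<forall>\<^sub>F \<kappa> in at_left (1 / mean). \<kappa> \<in> {0<..<1 / mean}"
      using mean by (intro eventually_at_leftI[of 0]) auto
    ultimately have "\<forall>\<^sub>F \<kappa> in at_left (1 / mean). exp (- (\<kappa> * y)) < a \<and> \<kappa> \<in> {0<..<1 / mean}"
      by (rule eventually_conj)
    then obtain \<kappa> where \<kappa>: "exp (- (\<kappa> * y)) < a" "0 < \<kappa>" "\<kappa> < 1 / mean"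
      using eventually_happens'[of "at_left (1 / mean)"] by (auto simp: trivial_limit_at_left_real)
    have "\<kappa> * mean < 1" using \<kappa> mean by (simp add: field_simps)
    \<comment> \<open>Halving the logarithm leaves room on both sides: delta is positive, and the factor exp delta, lost in the truncated moment, keeps the drift below one.\<close>
    define \<delta> where "\<delta> = - ln (\<kappa> * mean) / 2"
    have \<delta>: "\<delta> > 0" "exp \<delta> * (\<kappa> * mean) < 1"
    proof -
      have "ln (\<kappa> * mean) < 0" using \<open>\<kappa> * mean < 1\<close> \<kappa> mean by simp
      then show "\<delta> > 0" by (simp add: \<delta>_def)
      have "exp \<delta> * exp (ln (\<kappa> * mean)) < 1"
        using \<open>ln (\<kappa> * mean) < 0\<close> by (simp add: \<delta>_def exp_add[symmetric])
      then show "exp \<delta> * (\<kappa> * mean) < 1" using \<kappa> mean by simp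
    qed
    define n where "n x = nat \<lfloor>\<kappa> * x\<rfloor>" for x
    \<comment> \<open>Minus the total exponent of the Chernoff term in the upper bound with parameter delta / tau x.\<close>
    define E where "E x = x / \<tau> x * (\<delta> * (1 - \<tau> x / x - real (n x) / x * exp \<delta> * mean))" for x
    have x\<tau>: "filterlim (\<lambda>x. x / \<tau> x) at_top at_top"
    proof -
      have "filterlim (\<lambda>x. inverse (\<tau> x / x)) at_top at_top"
      proof (rule filterlim_inverse_at_top[OF \<tau>x])
        show "\<forall>\<^sub>F x in at_top. 0 < \<tau> x / x"
          using \<tau>_pos eventually_gt_at_top[of 0] by eventually_elim simp
      qed
      then show ?thesis by simp
    qed
    have "((\<lambda>x. \<delta> * (1 - \<tau> x / x - real (n x) / x * exp \<delta> * mean)) \<longlongrightarrow> \<delta> * (1 - 0 - \<kappa> * exp \<delta> * mean)) at_top"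
      unfolding n_def using \<kappa> by (intro tendsto_intros \<tau>x nat_floor_mult_over_tendsto) auto
    moreover have "\<delta> * (1 - 0 - \<kappa> * exp \<delta> * mean) > 0" using \<delta> by (simp add: mult_ac)
    ultimately have "filterlim E at_top at_top"
      unfolding E_def using x\<tau> by (rule filterlim_at_top_mult_tendsto_pos)
    then have "((\<lambda>x. exp (- E x)) \<longlongrightarrow> 0) at_top"
      by (auto intro!: filterlim_compose[OF exp_at_bot] simp: filterlim_uminus_at_top[symmetric] filterlim_uminus_at_bot)
    then have "((\<lambda>x. (1 - G_tail (\<tau> x)) ^ n x + exp (- E x)) \<longlongrightarrow> exp (- (\<kappa> * y)) + 0) at_top"
      unfolding n_def using \<kappa> xp by (intro tendsto_add no_failure_limit) auto
    then have "\<forall>\<^sub>F x in at_top. (1 - G_tail (\<tau> x)) ^ n x + exp (- E x) < a"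
      using \<kappa> by (intro order_tendstoD(2)) auto
    then show "\<forall>\<^sub>F x in at_top. restart_tail x (\<tau> x) < a"
      using \<tau>_pos eventually_gt_at_top[of 0]
    proof eventually_elim
      case (elim x)
      have "- (\<delta> / \<tau> x * (x - \<tau> x)) + real (n x) * (\<delta> / \<tau> x * exp (\<delta> / \<tau> x * \<tau> x) * mean) = - E x"
        using elim by (simp add: E_def field_simps)
      then have "exp (- (\<delta> / \<tau> x * (x - \<tau> x))) * exp (\<delta> / \<tau> x * exp (\<delta> / \<tau> x * \<tau> x) * mean) ^ n x = exp (- E x)"
        by (simp add: exp_of_nat_mult[symmetric] exp_add[symmetric])
      then show ?case
        using restart_tail_upper[of "\<delta> / \<tau> x" "\<tau> x" x "n x"] \<delta> elim by simp
    qed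
  next
    fix a assume a: "a < exp (- (y / mean))"
    have "\<forall>\<^sub>F \<kappa> in at_right (1 / mean). a < exp (- (\<kappa> * y))"
      using a by (intro order_tendstoD(1)[OF cont]) simp
    moreover have "\<forall>\<^sub>F \<kappa> in at_right (1 / mean). 1 / mean < \<kappa>"
      by (rule eventually_at_right_less)
    ultimately have "\<forall>\<^sub>F \<kappa> in at_right (1 / mean). a < exp (- (\<kappa> * y)) \<and> 1 / mean < \<kappa>"
      by (rule eventually_conj)
    then obtain \<kappa> where \<kappa>: "a < exp (- (\<kappa> * y))" "1 / mean < \<kappa>"
      using eventually_happens'[of "at_right (1 / mean)"] by (auto simp: trivial_limit_at_right_real)
    have \<kappa>_pos: "\<kappa> > 0" using \<kappa>(2) mean by (meson divide_pos_pos less_trans zero_less_one)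
    have "1 / \<kappa> < mean" using \<kappa> \<kappa>_pos mean by (simp add: field_simps)
    then obtain b where b: "1 / \<kappa> < b" "b < mean" using dense by blast
    obtain \<theta> where \<theta>: "\<theta> > 0" "expectation (\<lambda>\<omega>. exp (- (\<theta> * U 1 \<omega>))) \<le> 1 - \<theta> * b"
      using laplace_below_mean[OF b(2)] by blast
    have le: "expectation (\<lambda>\<omega>. exp (- (\<theta> * U 1 \<omega>))) \<le> exp (- (\<theta> * b))"
      using \<theta>(2) exp_ge_add_one_self[of "- (\<theta> * b)"] by linarith
    define n where "n x = nat \<lfloor>\<kappa> * x\<rfloor>" for x
    \<comment> \<open>Minus the total exponent of the Chernoff term in the lower bound.\<close>
    define E where "E x = x * (\<theta> * (real (n x) / x * b - 1))" for x
    have "((\<lambda>x. \<theta> * (real (n x) / x * b - 1)) \<longlongrightarrow> \<theta> * (\<kappa> * b - 1)) at_top"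
      unfolding n_def using \<kappa>_pos by (intro tendsto_intros nat_floor_mult_over_tendsto) auto
    moreover have "\<theta> * (\<kappa> * b - 1) > 0" using \<theta> b \<kappa>_pos by (simp add: field_simps)
    ultimately have "filterlim E at_top at_top"
      unfolding E_def using filterlim_ident by (rule filterlim_at_top_mult_tendsto_pos)
    then have "((\<lambda>x. exp (- E x)) \<longlongrightarrow> 0) at_top"
      by (auto intro!: filterlim_compose[OF exp_at_bot] simp: filterlim_uminus_at_top[symmetric] filterlim_uminus_at_bot)
    then have "((\<lambda>x. (1 - G_tail (\<tau> x)) ^ n x - exp (- E x)) \<longlongrightarrow> exp (- (\<kappa> * y)) - 0) at_top"
      unfolding n_def using \<kappa>_pos xp by (intro tendsto_diff no_failure_limit) auto
    then have "\<forall>\<^sub>F x in at_top. a < (1 - G_tail (\<tau> x)) ^ n x - exp (- E x)"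
      using \<kappa> by (intro order_tendstoD(1)) auto
    then show "\<forall>\<^sub>F x in at_top. a < restart_tail x (\<tau> x)"
      using \<tau>_pos eventually_gt_at_top[of 0]
    proof eventually_elim
      case (elim x)
      have "\<theta> * x + real (n x) * (- (\<theta> * b)) = - E x"
        using elim by (simp add: E_def field_simps)
      then have "exp (\<theta> * x) * exp (- (\<theta> * b)) ^ n x = exp (- E x)"
        by (simp add: exp_of_nat_mult[symmetric] exp_add[symmetric])
      then show ?case
        using restart_tail_lower[of \<theta> "\<tau> x" "exp (- (\<theta> * b))" "n x" x] \<theta> le elim by simp
    qed
  qed
qed

section \<open>Mixing over the task time\<close>

text \<open>
  Conditioning on \<open>T\<close>, as Fubini's theorem for the product law of \<open>T\<close> and the sequence of failure times. The event is
  the preimage of the set \<open>Q\<close> of pairs of a task length and a failure sequence, and the section of \<open>Q\<close> at \<open>t\<close> is the event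
  for a task of fixed length \<open>t\<close>.
\<close>

lemma
  shows restart_tail_measurable: "restart_tail x \<in> borel_measurable borel"
    and restart_tail_mixture:
      "ennreal (tail_prob M (restart_X T U) (ereal x)) = (\<integral>\<^sup>+t. ennreal (restart_tail x t) \<partial>distr M borel T)"
proof -
  let ?X = "\<lambda>n::nat. if n = 0 then T else U n"
  let ?P = "\<Pi>\<^sub>M i\<in>{1::nat..}. (borel :: real measure)"
  \<comment> \<open>Restricting a family to disjoint index sets gives independent elements of product spaces; the one over {0} is then projected to T.\<close>
  let ?PT = "\<Pi>\<^sub>M i\<in>{0::nat}. (borel :: real measure)"
  define Y0 where "Y0 \<omega> = restrict (\<lambda>n. ?X n \<omega>) {0}" for \<omega>
  define Y where "Y \<omega> = restrict (\<lambda>n. ?X n \<omega>) {1..}" for \<omega>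
  have "indep_var ?PT Y0 ?P Y"
    unfolding Y0_def Y_def using T_U_indep by (rule indep_var_restrict) auto
  then have Y0 [measurable]: "Y0 \<in> M \<rightarrow>\<^sub>M ?PT" and Y [measurable]: "Y \<in> M \<rightarrow>\<^sub>M ?P"
    and joint0: "distr M ?PT Y0 \<Otimes>\<^sub>M distr M ?P Y = distr M (?PT \<Otimes>\<^sub>M ?P) (\<lambda>\<omega>. (Y0 \<omega>, Y \<omega>))"
    by (auto simp: indep_var_distribution_eq)
  interpret Y: prob_space "distr M ?P Y" by (rule prob_space_distr) measurable
  have v0 [measurable]: "(\<lambda>v. v 0) \<in> borel_measurable ?PT"
    by (rule measurable_component_singleton) simp
  have T_Y0: "T \<omega> = Y0 \<omega> 0" for \<omega> by (simp add: Y0_def)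
  have "distr M borel T \<Otimes>\<^sub>M distr M ?P Y
      = distr (distr M ?PT Y0) borel (\<lambda>v. v 0) \<Otimes>\<^sub>M distr (distr M ?P Y) ?P (\<lambda>u. u)"
    by (simp add: distr_distr comp_def T_Y0[symmetric])
  also have "\<dots> = distr (distr M ?PT Y0 \<Otimes>\<^sub>M distr M ?P Y) (borel \<Otimes>\<^sub>M ?P) (\<lambda>(v, u). (v 0, u))"
    using Y.sigma_finite_measure_axioms by (intro pair_measure_distr) (simp_all add: distr_distr comp_def)
  also have "\<dots> = distr M (borel \<Otimes>\<^sub>M ?P) (\<lambda>\<omega>. (T \<omega>, Y \<omega>))"
    unfolding joint0 by (subst distr_distr) (auto simp: comp_def T_Y0)
  finally have joint: "distr M borel T \<Otimes>\<^sub>M distr M ?P Y = distr M (borel \<Otimes>\<^sub>M ?P) (\<lambda>\<omega>. (T \<omega>, Y \<omega>))" .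
  define Q where "Q = {z \<in> space (borel \<Otimes>\<^sub>M ?P). \<forall>n. snd z (Suc n) > fst z \<longrightarrow>
    (\<forall>i<n. snd z (Suc i) \<le> fst z) \<longrightarrow> x < fst z + (\<Sum>i<n. snd z (Suc i))}"
  have comp [measurable]: "(\<lambda>z. snd z (Suc i)) \<in> borel_measurable (borel \<Otimes>\<^sub>M ?P)" for i
    by (rule measurable_compose[OF measurable_snd measurable_component_singleton]) simp
  have Q: "Q \<in> sets (borel \<Otimes>\<^sub>M ?P)" unfolding Q_def by measurable
  have Q': "Q \<in> sets (distr M borel T \<Otimes>\<^sub>M distr M ?P Y)"
    using Q by (simp cong: sets_pair_measure_cong)
  have Y_Suc: "Y \<omega> (Suc i) = U (Suc i) \<omega>" for \<omega> i by (simp add: Y_def)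
  have Y_space: "Y \<omega> \<in> space ?P" if "\<omega> \<in> space M" for \<omega>
    using that Y by (rule measurable_space[rotated])
  have slice: "emeasure (distr M ?P Y) (Pair t -` Q) = ennreal (restart_tail x t)" for t
  proof -
    have "Pair t -` Q \<in> sets ?P" using Q by (rule sets_Pair1)
    then have "emeasure (distr M ?P Y) (Pair t -` Q) = emeasure M (Y -` (Pair t -` Q) \<inter> space M)"
      by (rule emeasure_distr[OF Y])
    also have "Y -` (Pair t -` Q) \<inter> space M = {\<omega> \<in> space M. restart_X (\<lambda>_. t) U \<omega> > ereal x}"
      using Y_space by (auto simp: Q_def restart_X_gt_iff Y_Suc space_pair_measure)
    finally show ?thesis by (simp add: restart_tail_def tail_prob_def emeasure_eq_measure)
  qed
  have "(\<lambda>t. emeasure (distr M ?P Y) (Pair t -` Q)) \<in> borel_measurable (distr M borel T)"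
    using Q' by (rule Y.measurable_emeasure_Pair)
  then have "(\<lambda>t. ennreal (restart_tail x t)) \<in> borel_measurable borel" by (simp add: slice)
  then have "(\<lambda>t. enn2real (ennreal (restart_tail x t))) \<in> borel_measurable borel" by measurable
  then show "restart_tail x \<in> borel_measurable borel" by (simp add: restart_tail_bounds)
  have "ennreal (tail_prob M (restart_X T U) (ereal x)) = emeasure M {\<omega> \<in> space M. restart_X T U \<omega> > ereal x}"
    by (simp add: tail_prob_def emeasure_eq_measure)
  also have "{\<omega> \<in> space M. restart_X T U \<omega> > ereal x} = (\<lambda>\<omega>. (T \<omega>, Y \<omega>)) -` Q \<inter> space M"
    using Y_space by (auto simp: Q_def restart_X_gt_iff Y_Suc space_pair_measure)
  also have "emeasure M \<dots> = emeasure (distr M (borel \<Otimes>\<^sub>M ?P) (\<lambda>\<omega>. (T \<omega>, Y \<omega>))) Q"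
    using Q by (intro emeasure_distr[symmetric]) measurable
  also have "\<dots> = (\<integral>\<^sup>+t. emeasure (distr M ?P Y) (Pair t -` Q) \<partial>distr M borel T)"
    unfolding joint[symmetric] using Q' by (rule Y.emeasure_pair_measure_alt)
  finally show "ennreal (tail_prob M (restart_X T U) (ereal x)) = (\<integral>\<^sup>+t. ennreal (restart_tail x t) \<partial>distr M borel T)"
    by (simp add: slice)
qed

section \<open>Uniform levels of the failure time\<close>

abbreviation "G_law \<equiv> distr M borel (U 1)"

text \<open>
  The densities extended by \<open>0\<close>. The given \<open>f\<close> and \<open>g\<close> may be arbitrary, even nonmeasurable, on the negative half-line.
\<close>

definition f_ext :: "real \<Rightarrow> real" where "f_ext t = indicator {0..} t * f t"
definition g_ext :: "real \<Rightarrow> real" where "g_ext t = indicator {0..} t * g t"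

lemma f_ext_nonneg: "0 \<le> f_ext t" and g_ext_nonneg: "0 \<le> g_ext t"
  using T_density U_density[of 1] by (auto simp: f_ext_def g_ext_def has_density_nonneg_def indicator_def)

lemma f_ext_measurable [measurable]: "f_ext \<in> borel_measurable borel"
  and g_ext_measurable [measurable]: "g_ext \<in> borel_measurable borel"
proof -
  have "(\<lambda>t. enn2real (ennreal (f_ext t))) \<in> borel_measurable borel"
    using T_density by (intro borel_measurable_enn2real) (auto simp: has_density_nonneg_def distributed_def f_ext_def)
  then show "f_ext \<in> borel_measurable borel" by (simp add: f_ext_nonneg)
  have "(\<lambda>t. enn2real (ennreal (g_ext t))) \<in> borel_measurable borel"
    using U_density[of 1] by (intro borel_measurable_enn2real) (auto simp: has_density_nonneg_def distributed_def g_ext_def)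
  then show "g_ext \<in> borel_measurable borel" by (simp add: g_ext_nonneg)
qed

lemma T_law: "distr M borel T = density lborel f_ext"
  and G_law: "G_law = density lborel g_ext"
  using T_density U_density[of 1]
  by (simp_all add: has_density_nonneg_def distributed_def f_ext_def[abs_def] g_ext_def[abs_def] distr_lborel_eq)

sublocale G: cdf_distribution G_law
  by (intro cdf_distribution.intro real_distribution_distr U1_measurable)

lemma cdf_G_law: "cdf G_law t = 1 - G_tail t"
proof -
  have "cdf G_law t = prob {\<omega> \<in> space M. U 1 \<omega> \<le> t}"
    unfolding cdf_def by (subst measure_distr) (auto intro!: arg_cong[where f = prob])
  also have "\<dots> = 1 - G_tail t"
    unfolding tail_prob_def by (subst prob_compl[symmetric]) (auto intro!: arg_cong[where f = prob])
  finally show ?thesis .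
qed

text \<open>
  The generalised inverse of \<open>G_tail\<close>, i.e. the quantile function of the failure time at level \<open>1 - s\<close>. Working with the tail
  level \<open>s\<close> turns large task lengths into the neighbourhood of \<open>0\<close>.
\<close>

definition quantile :: "real \<Rightarrow> real" where
  "quantile s = (if 0 < s \<and> s < 1 then Inf {t. 1 - s \<le> cdf G_law t} else 0)"

lemma quantile_le_iff: "0 < s \<Longrightarrow> s < 1 \<Longrightarrow> quantile s \<le> t \<longleftrightarrow> G_tail t \<le> s"
  using G.pseudoinverse[of "1 - s" t] by (auto simp: quantile_def cdf_G_law)

text \<open>
  Equality, and not only an inequality, holds because a law with a density has no atoms.
\<close>

lemma G_tail_quantile:
  assumes s: "0 < s" "s < 1"
  shows "G_tail (quantile s) = s"
proof (rule antisym)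
  show "G_tail (quantile s) \<le> s" using quantile_le_iff[OF s, of "quantile s"] by simp
  have "emeasure G_law {quantile s} = 0"
    unfolding G_law by (subst emeasure_density) (auto intro!: nn_integral_null_set)
  then have "isCont (cdf G_law) (quantile s)" by (simp add: G.isCont_cdf measure_def)
  then have "((cdf G_law) \<longlongrightarrow> cdf G_law (quantile s)) (at_left (quantile s))"
    by (simp add: isCont_def filterlim_at_split)
  moreover have "\<forall>\<^sub>F t in at_left (quantile s). cdf G_law t \<le> 1 - s"
  proof (rule eventually_at_leftI[of "quantile s - 1"])
    fix t assume "t \<in> {quantile s - 1<..<quantile s}"
    then show "cdf G_law t \<le> 1 - s" using quantile_le_iff[OF s, of t] by (simp add: cdf_G_law)
  qed simp
  ultimately have "cdf G_law (quantile s) \<le> 1 - s"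
    by (rule tendsto_upperbound) simp
  then show "s \<le> G_tail (quantile s)" by (simp add: cdf_G_law)
qed

lemma quantile_nonneg: "0 \<le> quantile s"
proof (rule ccontr)
  assume neg: "\<not> 0 \<le> quantile s"
  then have s: "0 < s" "s < 1" by (auto simp: quantile_def split: if_splits)
  have "AE \<omega> in M. quantile s < U 1 \<omega>"
    using U_nonneg[OF order_refl] by eventually_elim (use neg in auto)
  then have "G_tail (quantile s) = 1"
    unfolding tail_prob_def by (subst prob_Collect_eq_1) auto
  then show False using G_tail_quantile[OF s] s by simp
qed

lemma quantile_measurable [measurable]: "quantile \<in> borel_measurable borel"
proof -
  have "(\<lambda>\<omega>. if \<omega> \<in> {0<..<1} then Inf {t. \<omega> \<le> cdf G_law t} else 0) \<in> borel_measurable borel"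
    using G.measurable_CI by (subst (asm) measurable_restrict_space_iff[where c = 0]) auto
  then have "(\<lambda>s. if 1 - s \<in> {0<..<1} then Inf {t. 1 - s \<le> cdf G_law t} else 0) \<in> borel_measurable borel"
    by (rule measurable_compose[rotated]) measurable
  also have "(\<lambda>s. if 1 - s \<in> {0<..<1} then Inf {t. 1 - s \<le> cdf G_law t} else 0) = quantile"
    by (auto simp: quantile_def fun_eq_iff)
  finally show ?thesis .
qed

text \<open>
  A quantile of a uniform level has law \<open>G_law\<close>; the reflection \<open>s = 1 - \<omega>\<close> passes to tail levels.
\<close>

lemma nn_integral_quantile:
  assumes [measurable]: "\<phi> \<in> borel_measurable borel"
  shows "(\<integral>\<^sup>+t. \<phi> t \<partial>G_law) = (\<integral>\<^sup>+s. indicator {0<..<1} s * \<phi> (quantile s) \<partial>lborel)"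
proof -
  let ?I = "\<lambda>\<omega>. Inf {t. \<omega> \<le> cdf G_law t}"
  have I: "?I \<in> borel_measurable (restrict_space lborel {0<..<1})"
    using G.measurable_CI by (simp cong: measurable_cong_sets)
  have "(\<integral>\<^sup>+t. \<phi> t \<partial>G_law) = (\<integral>\<^sup>+t. \<phi> t \<partial>distr (restrict_space lborel {0<..<1}) borel ?I)"
    by (simp add: G.distr_I_eq_M)
  also have "\<dots> = (\<integral>\<^sup>+\<omega>. \<phi> (?I \<omega>) \<partial>restrict_space lborel {0<..<1})"
    using I by (rule nn_integral_distr) simp
  also have "\<dots> = (\<integral>\<^sup>+\<omega>. \<phi> (?I \<omega>) * indicator {0<..<1} \<omega> \<partial>lborel)"
    by (rule nn_integral_restrict_space) simp
  also have "\<dots> = (\<integral>\<^sup>+\<omega>. indicator {0<..<1} (1 - \<omega>) * \<phi> (quantile (1 - \<omega>)) \<partial>lborel)"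
    by (intro nn_integral_cong) (auto simp: quantile_def indicator_def)
  also have "\<dots> = (\<integral>\<^sup>+s. indicator {0<..<1} s * \<phi> (quantile s) \<partial>lborel)"
    by (subst (2) nn_integral_real_affine[where c = "-1" and t = 1]) auto
  finally show ?thesis .
qed

lemma AE_quantile:
  assumes P: "AE t in G_law. P t"
  shows "AE s in lborel. 0 < s \<and> s < 1 \<longrightarrow> P (quantile s)"
proof -
  obtain N where N: "{t \<in> space G_law. \<not> P t} \<subseteq> N" "emeasure G_law N = 0" "N \<in> sets G_law"
    using P by (rule AE_E)
  have [measurable]: "N \<in> sets borel" using N by simp
  have "(\<integral>\<^sup>+s. indicator {0<..<1} s * indicator N (quantile s) \<partial>lborel) = emeasure G_law N"
    using N by (simp add: nn_integral_quantile[symmetric])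
  then have "AE s in lborel. indicator {0<..<1} s * (indicator N (quantile s) :: ennreal) = 0"
    using N by (subst nn_integral_0_iff_AE[symmetric]) auto
  then show ?thesis
    by eventually_elim (use N in \<open>auto simp: indicator_def split: if_splits\<close>)
qed

lemma AE_failure_density_pos: "AE t in G_law. 0 \<le> t \<and> 0 < g t"
proof -
  have "AE t in density lborel g_ext. 0 < ennreal (g_ext t)"
    by (subst AE_density) auto
  then show ?thesis
    unfolding G_law
  proof eventually_elim
    case (elim t)
    then show ?case by (cases "0 \<le> t") (auto simp: g_ext_def)
  qed
qed

end

section \<open>Asymptotics of the total time\<close>

locale restart_slowly_varying = restart_model +
  fixes \<beta> :: real and L0 :: "real \<Rightarrow> real"
  assumes \<beta>_pos: "\<beta> > 0" and L0: "slowly_varying_at_0 L0"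
    and f_eq: "\<And>t. t \<ge> 0 \<Longrightarrow> f t = g t * G_tail t powr (\<beta> - 1) * L0 (G_tail t)"
begin

text \<open>
  If \<open>G_tail\<close> vanished at some point, it would vanish from there on, and with it \<open>f\<close>, because \<open>0 powr a = 0\<close>. The task time
  would be bounded.
\<close>

lemma G_tail_pos: "0 < G_tail Z"
proof (rule ccontr)
  assume "\<not> 0 < G_tail Z"
  define b where "b = max Z 0"
  have zero: "G_tail t = 0" if "b \<le> t" for t
    using G_tail_antimono[of Z t] that \<open>\<not> 0 < G_tail Z\<close> G_tail_bounds(1)[of t] by (simp add: b_def)
  then have f_ext_zero: "f_ext t = 0" if "t < 0 \<or> b < t" for t
    using that f_eq[of t] by (auto simp: f_ext_def indicator_def)
  have "measure_support (distr M borel T) \<subseteq> {0..b}"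
  proof
    fix t assume t: "t \<in> measure_support (distr M borel T)"
    show "t \<in> {0..b}"
    proof (rule ccontr)
      assume "t \<notin> {0..b}"
      then have "t \<in> {..<0} \<union> {b<..}" by auto
      then have "emeasure (distr M borel T) ({..<0} \<union> {b<..}) > 0"
        using t open_Un[OF open_lessThan open_greaterThan] unfolding measure_support_def by blast
      moreover have "emeasure (distr M borel T) ({..<0} \<union> {b<..})
          = (\<integral>\<^sup>+t. ennreal (f_ext t) * indicator ({..<0} \<union> {b<..}) t \<partial>lborel)"
        unfolding T_law by (rule emeasure_density) auto
      moreover have "\<dots> = (\<integral>\<^sup>+t. 0 \<partial>(lborel :: real measure))"
        using f_ext_zero by (intro nn_integral_cong) (auto simp: indicator_def)
      ultimately show False by simp
    qed
  qed
  then have "bounded (measure_support (distr M borel T))"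
    using bounded_closed_interval bounded_subset by blast
  then show False using T_support_unbounded by simp
qed

lemma mean_pos: "mean > 0"
  using mult_G_tail_le_mean[of 1] G_tail_pos[of 1] by simp

lemma quantile_at_top: "filterlim quantile at_top (at_right 0)"
  unfolding filterlim_at_top_dense
proof
  fix Z
  have "\<forall>\<^sub>F s in at_right 0. s \<in> {0<..<min 1 (G_tail Z)}"
    using G_tail_pos[of Z] by (intro eventually_at_rightI[of 0 "min 1 (G_tail Z)"]) auto
  then show "\<forall>\<^sub>F s in at_right 0. Z < quantile s"
    by eventually_elim (use quantile_le_iff[of _ Z] in force)
qed

text \<open>
  The hypotheses determine \<open>L0\<close> up to a null set on the levels in \<open>(0, 1)\<close>, and its measurability elsewhere is
  unknown. Only the values near \<open>0\<close> enter the conclusion, so \<open>L0\<close> is continued by \<open>1\<close>.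
\<close>

definition L_ext :: "real \<Rightarrow> real" where
  "L_ext s = (if 0 < s \<and> s < 1 then L0 s else 1)"

lemma L0_ratio: "c > 0 \<Longrightarrow> ((\<lambda>s. L0 (c * s) / L0 s) \<longlongrightarrow> 1) (at_right 0)"
  using L0 by (simp add: slowly_varying_at_0_def)

lemma L_ext_ratio:
  assumes c: "c > 0"
  shows "((\<lambda>s. L_ext (c * s) / L_ext s) \<longlongrightarrow> 1) (at_right 0)"
proof (rule Lim_transform_eventually[OF L0_ratio[OF c]])
  have "\<forall>\<^sub>F s in at_right 0. s \<in> {0<..<min 1 (1 / c)}"
    using c by (intro eventually_at_rightI[of 0 "min 1 (1 / c)"]) auto
  then show "\<forall>\<^sub>F s in at_right 0. L0 (c * s) / L0 s = L_ext (c * s) / L_ext s"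
    by eventually_elim (use c in \<open>auto simp: L_ext_def field_simps\<close>)
qed

lemma L_ext_bounded:
  assumes b: "0 < b"
  shows "\<exists>B. \<forall>s\<in>{b..1}. \<bar>L_ext s\<bar> \<le> B"
proof -
  have "compact {b..1}" "{b..1} \<subseteq> {0<..}" using b by auto
  then have "bounded (L0 ` {b..1})"
    using L0 unfolding slowly_varying_at_0_def by blast
  then obtain B where B: "\<forall>y\<in>L0 ` {b..1}. norm y \<le> B"
    unfolding bounded_iff by blast
  show ?thesis
    by (rule exI[of _ "max 1 B"]) (use B in \<open>auto simp: L_ext_def le_max_iff_disj\<close>)
qed

text \<open>
  The relation between the densities at the level \<open>s = G_tail t\<close>. It can be solved for \<open>L0 s\<close> where \<open>g > 0\<close>, which is
  almost everywhere under the law of the failure time, and so at the quantiles of almost all levels. This yields the measurability of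
  \<open>L_ext\<close> in the next lemma.
\<close>

lemma AE_density_ratio:
  "AE s in lborel. 0 < s \<and> s < 1 \<longrightarrow> f_ext (quantile s) / g_ext (quantile s) = s powr (\<beta> - 1) * L_ext s"
  using AE_quantile[OF AE_failure_density_pos]
proof eventually_elim
  case (elim s)
  show ?case
  proof
    assume s: "0 < s \<and> s < 1"
    then show "f_ext (quantile s) / g_ext (quantile s) = s powr (\<beta> - 1) * L_ext s"
      using elim f_eq[of "quantile s"] G_tail_quantile[of s] by (simp add: f_ext_def g_ext_def L_ext_def)
  qed
qed

lemma L_ext_measurable: "L_ext \<in> borel_measurable lebesgue"
proof (rule borel_measurable_lebesgue_cong_AE)
  show "(\<lambda>s. if 0 < s \<and> s < 1 then f_ext (quantile s) / g_ext (quantile s) / s powr (\<beta> - 1) else 1)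
      \<in> borel_measurable borel"
    by measurable
  show "AE s in lborel. L_ext s = (if 0 < s \<and> s < 1 then f_ext (quantile s) / g_ext (quantile s) / s powr (\<beta> - 1) else 1)"
    using AE_density_ratio by eventually_elim (auto simp: L_ext_def)
qed

definition quantile_tail :: "real \<Rightarrow> real \<Rightarrow> real" where
  "quantile_tail x s = (if 0 < s \<and> s < 1 then restart_tail x (quantile s) else 0)"

lemma quantile_tail_measurable_borel [measurable]: "quantile_tail x \<in> borel_measurable borel"
  unfolding quantile_tail_def using restart_tail_measurable[of x] by measurable

text \<open>
  The law of \<open>T\<close> has density \<open>f_ext / g_ext\<close> with respect to the law of \<open>U 1\<close>, whose quantile representation turns the
  mixture over \<open>t\<close> into an integral over levels.
\<close>

lemma tail_eq_integral:
  "tail_prob M (restart_X T U) (ereal x)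
    = (\<integral>s. indicator {0<..<1} s * (s powr (\<beta> - 1) * L_ext s * quantile_tail x s) \<partial>lebesgue)"
proof -
  note [measurable] = restart_tail_measurable[of x]
  let ?r = "\<lambda>t. f_ext t / g_ext t"
  let ?F = "\<lambda>s. indicator {0<..<1} s * (?r (quantile s) * quantile_tail x s)"
  \<comment> \<open>Where g vanishes, so does f; thus the value 0 of a quotient by zero is the right one.\<close>
  have f_g_ratio: "f_ext t = g_ext t * ?r t" for t
    using f_eq[of t] by (auto simp: f_ext_def g_ext_def indicator_def)
  have "ennreal (tail_prob M (restart_X T U) (ereal x)) = (\<integral>\<^sup>+t. ennreal (restart_tail x t) \<partial>density lborel f_ext)"
    by (simp add: restart_tail_mixture T_law)
  also have "\<dots> = (\<integral>\<^sup>+t. ennreal (f_ext t) * ennreal (restart_tail x t) \<partial>lborel)"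
    by (rule nn_integral_density) measurable
  also have "\<dots> = (\<integral>\<^sup>+t. ennreal (g_ext t) * ennreal (?r t * restart_tail x t) \<partial>lborel)"
    by (intro nn_integral_cong, subst f_g_ratio)
      (simp add: ennreal_mult[symmetric] f_ext_nonneg g_ext_nonneg restart_tail_bounds mult.assoc)
  also have "\<dots> = (\<integral>\<^sup>+t. ennreal (?r t * restart_tail x t) \<partial>density lborel g_ext)"
    by (rule nn_integral_density[symmetric]) measurable
  also have "\<dots> = (\<integral>\<^sup>+s. indicator {0<..<1} s * ennreal (?r (quantile s) * restart_tail x (quantile s)) \<partial>lborel)"
    unfolding G_law[symmetric] by (rule nn_integral_quantile) measurable
  also have "\<dots> = (\<integral>\<^sup>+s. ennreal (?F s) \<partial>lborel)"
    by (intro nn_integral_cong) (auto simp: indicator_def quantile_tail_def)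
  finally have "tail_prob M (restart_X T U) (ereal x) = enn2real (\<integral>\<^sup>+s. ennreal (?F s) \<partial>lborel)"
    by (metis enn2real_ennreal measure_nonneg tail_prob_def)
  also have "\<dots> = (\<integral>s. ?F s \<partial>lborel)"
    by (rule integral_eq_nn_integral[symmetric])
      (auto simp: indicator_def quantile_tail_def f_ext_nonneg g_ext_nonneg restart_tail_bounds)
  also have "\<dots> = (\<integral>s. ?F s \<partial>lebesgue)"
    by (rule integral_completion[symmetric]) measurable
  also have "\<dots> = (\<integral>s. indicator {0<..<1} s * (s powr (\<beta> - 1) * L_ext s * quantile_tail x s) \<partial>lebesgue)"
  proof (rule integral_cong_AE)
    have bl: "h \<in> borel_measurable borel \<Longrightarrow> h \<in> borel_measurable lebesgue" for h :: "real \<Rightarrow> real"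
      by (simp add: measurable_completion)
    show "?F \<in> borel_measurable lebesgue" by (rule bl) measurable
    show "(\<lambda>s. indicator {0<..<1} s * (s powr (\<beta> - 1) * L_ext s * quantile_tail x s)) \<in> borel_measurable lebesgue"
      using L_ext_measurable by (intro borel_measurable_times) (auto intro!: bl)
    show "AE s in lebesgue. ?F s = indicator {0<..<1} s * (s powr (\<beta> - 1) * L_ext s * quantile_tail x s)"
      using AE_completion[OF AE_density_ratio]
    proof eventually_elim
      case (elim s)
      show ?case
      proof (cases "0 < s \<and> s < 1")
        case True
        with elim have ratio: "f_ext (quantile s) / g_ext (quantile s) = s powr (\<beta> - 1) * L_ext s" by blast
        show ?thesis unfolding ratio by (rule refl)
      qed auto
    qed
  qed
  finally show ?thesis .
qed

text \<open>
  At the level \<open>y / x\<close> the task length \<open>\<tau> x = quantile (y / x)\<close> satisfies \<open>\<tau> x / x = \<tau> x * G_tail (\<tau> x) / y\<close>, which vanishes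
  in the limit, so \<open>restart_tail_limit\<close> applies.
\<close>

lemma quantile_tail_limit:
  assumes y: "y > 0"
  shows "((\<lambda>x. quantile_tail x (y / x)) \<longlongrightarrow> exp (- (y / mean))) at_top"
proof -
  define \<tau> where "\<tau> x = quantile (y / x)" for x
  have ev: "\<forall>\<^sub>F x in at_top. x > 0 \<and> 0 < y / x \<and> y / x < 1"
    using eventually_gt_at_top[of y] by eventually_elim (use y in \<open>auto simp: field_simps\<close>)
  have yx: "filterlim (\<lambda>x. y / x) (at_right 0) at_top"
  proof -
    have "((\<lambda>x. y / x) \<longlongrightarrow> 0) at_top"
      by (rule tendsto_divide_0[OF tendsto_const]) (auto intro: filterlim_at_top_imp_at_infinity filterlim_ident)
    then show ?thesis using ev by (auto simp: filterlim_at elim: eventually_mono)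
  qed
  have \<tau>: "filterlim \<tau> at_top at_top"
    unfolding \<tau>_def using quantile_at_top yx by (rule filterlim_compose)
  have G\<tau>: "\<forall>\<^sub>F x in at_top. G_tail (\<tau> x) = y / x"
    using ev by eventually_elim (simp add: \<tau>_def G_tail_quantile)
  have "((\<lambda>x. \<tau> x * G_tail (\<tau> x) / y) \<longlongrightarrow> 0 / y) at_top"
    using y by (intro tendsto_divide tendsto_const filterlim_compose[OF mult_G_tail_tendsto_0 \<tau>]) auto
  moreover have "\<forall>\<^sub>F x in at_top. \<tau> x * G_tail (\<tau> x) / y = \<tau> x / x"
    using G\<tau> ev by eventually_elim (use y in simp)
  ultimately have \<tau>x: "((\<lambda>x. \<tau> x / x) \<longlongrightarrow> 0) at_top"
    by (auto intro: Lim_transform_eventually)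
  have xp: "((\<lambda>x. x * G_tail (\<tau> x)) \<longlongrightarrow> y) at_top"
    by (rule tendsto_eventually) (use G\<tau> ev in \<open>eventually_elim, simp\<close>)
  have "((\<lambda>x. restart_tail x (\<tau> x)) \<longlongrightarrow> exp (- (y / mean))) at_top"
    by (rule restart_tail_limit[OF mean_pos \<tau> \<tau>x xp])
  moreover have "\<forall>\<^sub>F x in at_top. restart_tail x (\<tau> x) = quantile_tail x (y / x)"
    using ev by eventually_elim (simp add: quantile_tail_def \<tau>_def)
  ultimately show ?thesis by (rule Lim_transform_eventually)
qed

lemma tail_limit:
  "((\<lambda>x. x powr \<beta> / L_ext (1 / x) * tail_prob M (restart_X T U) (ereal x))
    \<longlongrightarrow> Gamma \<beta> / (1 / mean) powr \<beta>) at_top"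
proof -
  define c where "c = min (exp (- mean) / (2 * mean)) (1 / 2)"
  have bl: "h \<in> borel_measurable borel \<Longrightarrow> h \<in> borel_measurable lebesgue" for h :: "real \<Rightarrow> real"
    by (simp add: measurable_completion)
  have "((\<lambda>x. x powr \<beta> / L_ext (1 / x) *
        (\<integral>s. indicator {0<..<1} s * (s powr (\<beta> - 1) * L_ext s * quantile_tail x s) \<partial>lebesgue))
      \<longlongrightarrow> (\<integral>y. indicator {0<..} y * (y powr (\<beta> - 1) * exp (- (y / mean))) \<partial>lebesgue)) at_top"
  proof (rule abelian_slowly_varying[OF L_ext_measurable L_ext_ratio L_ext_bounded \<beta>_pos, where c = c and C = "exp 1 + exp mean"])
    show "c > 0" using mean_pos by (simp add: c_def)
    show "\<bar>quantile_tail x s\<bar> \<le> (exp 1 + exp mean) * exp (- (c * (x * s)))" if "x > 0" "0 < s" "s < 1" for x s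
      using restart_tail_exp_bound[OF mean_pos quantile_nonneg[of s], of x] that G_tail_quantile[of s]
      by (simp add: quantile_tail_def restart_tail_bounds c_def)
  qed (auto intro!: bl quantile_tail_limit)
  then show ?thesis
    using Gamma_integral_scaled[OF \<beta>_pos, of "1 / mean"] mean_pos
    by (simp add: tail_eq_integral has_bochner_integral_iff)
qed

lemma tail_asymptotics:
  assumes \<mu>: "\<mu> = 1 / mean"
  shows "(\<lambda>x::real. tail_prob M (restart_X T U) (ereal x))
    \<sim>[at_top] (\<lambda>x. Gamma \<beta> / \<mu> powr \<beta> * (L0 (1 / x) / x powr \<beta>))"
proof (rule asymp_equivI')
  let ?c = "Gamma \<beta> / \<mu> powr \<beta>"
  have c: "?c > 0" using Gamma_real_pos[OF \<beta>_pos] mean_pos by (simp add: \<mu>)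
  have "((\<lambda>x. (x powr \<beta> / L_ext (1 / x) * tail_prob M (restart_X T U) (ereal x)) / ?c) \<longlongrightarrow> ?c / ?c) at_top"
    using tail_limit c unfolding \<mu>[symmetric] by (intro tendsto_divide tendsto_const) auto
  moreover have "?c / ?c = 1" using c by (intro divide_self) auto
  ultimately have lim: "((\<lambda>x. (x powr \<beta> / L_ext (1 / x) * tail_prob M (restart_X T U) (ereal x)) / ?c) \<longlongrightarrow> 1) at_top"
    by (simp only:)
  show "((\<lambda>x. tail_prob M (restart_X T U) (ereal x) / (?c * (L0 (1 / x) / x powr \<beta>))) \<longlongrightarrow> 1) at_top"
  proof (rule Lim_transform_eventually[OF lim])
    show "\<forall>\<^sub>F x in at_top. (x powr \<beta> / L_ext (1 / x) * tail_prob M (restart_X T U) (ereal x)) / ?c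
        = tail_prob M (restart_X T U) (ereal x) / (?c * (L0 (1 / x) / x powr \<beta>))"
      using eventually_gt_at_top[of 1] by eventually_elim (simp add: L_ext_def mult_ac)
  qed
qed

end

theorem theorem2p2:
  fixes M :: "'a measure" and T :: "'a \<Rightarrow> real" and U :: "nat \<Rightarrow> 'a \<Rightarrow> real"
    and f g L0 :: "real \<Rightarrow> real" and \<beta> \<mu> :: real
  assumes "restart_model M T U f g"
    and "\<mu> = 1 / (LINT \<omega>|M. U 1 \<omega>)"
    and "\<beta> > 0"
    and "slowly_varying_at_0 L0"
    and "\<And>t. t \<ge> 0 \<Longrightarrow>
           f t = g t * tail_prob M (U 1) t powr (\<beta> - 1) * L0 (tail_prob M (U 1) t)"
  shows "(\<lambda>x::real. tail_prob M (restart_X T U) (ereal x))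
           \<sim>[at_top] (\<lambda>x. Gamma \<beta> / \<mu> powr \<beta> * (L0 (1 / x) / x powr \<beta>))"
proof -
  interpret restart_slowly_varying M T U f g \<beta> L0
    using assms by (intro restart_slowly_varying.intro restart_slowly_varying_axioms.intro) auto
  show ?thesis using assms(2) by (rule tail_asymptotics)
qed

end
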